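(* Let $n\ge2$ and let $T$ be a regular polytope in $\mathbb R^{n+1}$. For each strongly symmetric convex body $K\in\mathcal K(T)$, the functions $x_\alpha$, $\alpha=1,\dots,n+1$, satisfy $$\int_{\mathbb S^n}\frac{x_\alpha x_\beta}{h_K^2}\,dV_K=\frac{\delta_{\alpha\beta}}{n+1}\int_{\mathbb S^n}h_K^{-2}\,dV_K,\qquad\forall\,\alpha,\beta=1,2,\dots,n+1,$$ where $dV_K=h_K\det(\nabla^2h_K+h_KI)\,d\sigma$.
   Context: $\mathbb S^n\subset\mathbb R^{n+1}$ is the unit sphere, $d\sigma$ its $n$-dimensional Hausdorff (surface) measure, $x_1,\dots,x_{n+1}$ the restrictions to $\mathbb S^n$ of the Euclidean coordinates, and $\nabla^2$ the Hessian for the round metric in an orthonormal frame. $h_K(x)=\max_{z\in K}z\cdot x$ is the support function of a convex body $K$ containing the origin; it is assumed to be positive and smooth (at least $C^2$), so that $dV_K$ is defined as written. $\mathcal K(T)$ is the set of convex bodies $K$ whose support function is invariant under the symmetry group $\mathcal S(T)\subset O(n+1)$ of $T$ ($T$ centered at the origin). *)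

theory Defs
  imports "HOL-Analysis.Analysis"
begin

section \<open>Hausdorff measure\<close>

text \<open>
  The normalising factor is the volume of the \<open>d\<close>-dimensional ball of the same diameter.
  The library's \<^const>\<open>diameter\<close> is 0 on unbounded sets, hence the restriction to bounded covers.
\<close>

definition diam_vol :: "nat \<Rightarrow> 'a::metric_space set \<Rightarrow> ennreal" where
  "diam_vol d C = (if C = {} then 0 else ennreal (unit_ball_vol (real d) * (diameter C / 2) ^ d))"

definition hausdorff_covers :: "real \<Rightarrow> 'a::metric_space set \<Rightarrow> (nat \<Rightarrow> 'a set) set" where
  "hausdorff_covers \<delta> A = {C. A \<subseteq> (\<Union>i. C i) \<and> (\<forall>i. bounded (C i) \<and> diameter (C i) \<le> \<delta>)}"

definition hausdorff_pre :: "nat \<Rightarrow> real \<Rightarrow> 'a::metric_space set \<Rightarrow> ennreal" where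
  "hausdorff_pre d \<delta> A = (INF C\<in>hausdorff_covers \<delta> A. \<Sum>i. diam_vol d (C i))"

definition hausdorff_outer :: "nat \<Rightarrow> 'a::metric_space set \<Rightarrow> ennreal" where
  "hausdorff_outer d A = (SUP \<delta>\<in>{0<..}. hausdorff_pre d \<delta> A)"

definition hausdorff_measure :: "nat \<Rightarrow> 'a::metric_space measure" where
  "hausdorff_measure d = measure_of UNIV (sets borel) (hausdorff_outer d)"

text \<open>
  \<^const>\<open>measure_of\<close> returns the null measure when its argument is not countably additive.
  The lemmas up to \<open>emeasure_hausdorff_measure\<close> show that this does not happen here.
\<close>

lemma hausdorff_pre_mono:
  assumes "A \<subseteq> B" shows "hausdorff_pre d \<delta> A \<le> hausdorff_pre d \<delta> B"
  unfolding hausdorff_pre_def hausdorff_covers_def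
  by (rule INF_superset_mono) (use assms in auto)

lemma hausdorff_pre_antimono:
  assumes "\<delta> \<le> \<delta>'" shows "hausdorff_pre d \<delta>' A \<le> hausdorff_pre d \<delta> A"
  unfolding hausdorff_pre_def hausdorff_covers_def
  by (rule INF_superset_mono) (use assms in \<open>auto intro: order_trans\<close>)

lemma hausdorff_outer_mono: "A \<subseteq> B \<Longrightarrow> hausdorff_outer d A \<le> hausdorff_outer d B"
  unfolding hausdorff_outer_def by (intro SUP_mono') (rule hausdorff_pre_mono)

lemma hausdorff_outer_empty [simp]: "hausdorff_outer d {} = 0"
proof -
  have "hausdorff_pre d \<delta> ({} :: 'a set) = 0" if "\<delta> > 0" for \<delta>
  proof -
    have "(\<lambda>_. {}) \<in> hausdorff_covers \<delta> ({} :: 'a set)"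
      using that by (simp add: hausdorff_covers_def)
    then have "hausdorff_pre d \<delta> ({} :: 'a set) \<le> (\<Sum>i::nat. diam_vol d ({} :: 'a set))"
      unfolding hausdorff_pre_def by (rule INF_lower)
    then show ?thesis by (simp add: diam_vol_def)
  qed
  then show ?thesis by (auto simp: hausdorff_outer_def)
qed

lemma hausdorff_pre_subadditive:
  "hausdorff_pre d \<delta> (\<Union>i. A i) \<le> (\<Sum>i. hausdorff_pre d \<delta> (A i))"
proof (rule ennreal_le_epsilon)
  fix e :: real assume "0 < e" and fin: "(\<Sum>i. hausdorff_pre d \<delta> (A i)) < top"
  then have lt: "hausdorff_pre d \<delta> (A n) < hausdorff_pre d \<delta> (A n) + e * (1/2)^Suc n" for n
    by (auto simp add: less_top dest!: ennreal_suminf_lessD)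
  have "\<exists>C. C \<in> hausdorff_covers \<delta> (A n) \<and>
          (\<Sum>i. diam_vol d (C i)) < hausdorff_pre d \<delta> (A n) + e * (1/2)^Suc n" for n
    using lt[of n] unfolding hausdorff_pre_def INF_less_iff by blast
  then obtain C where C: "\<And>n. C n \<in> hausdorff_covers \<delta> (A n)"
    and le: "\<And>n. (\<Sum>i. diam_vol d (C n i)) < hausdorff_pre d \<delta> (A n) + e * (1/2)^Suc n"
    by metis
  let ?D = "\<lambda>k. case prod_decode k of (n, i) \<Rightarrow> C n i"
  have "(\<Union>n. A n) \<subseteq> (\<Union>k. ?D k)"
  proof
    fix x assume "x \<in> (\<Union>n. A n)"
    then obtain n i where "x \<in> C n i" using C by (fastforce simp: hausdorff_covers_def)
    then have "x \<in> ?D (prod_encode (n, i))" by simp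
    then show "x \<in> (\<Union>k. ?D k)" by (rule UN_I[OF UNIV_I])
  qed
  then have "?D \<in> hausdorff_covers \<delta> (\<Union>n. A n)"
    using C by (auto simp: hausdorff_covers_def split: prod.split)
  then have "hausdorff_pre d \<delta> (\<Union>n. A n) \<le> (\<Sum>k. diam_vol d (?D k))"
    unfolding hausdorff_pre_def by (rule INF_lower)
  also have "\<dots> = (\<Sum>n. \<Sum>i. diam_vol d (C n i))"
    using suminf_ennreal_2dimen[of "\<lambda>n. \<Sum>i. diam_vol d (C n i)" "\<lambda>(n, i). diam_vol d (C n i)"]
    by (simp add: o_def case_prod_unfold)
  also have "\<dots> \<le> (\<Sum>n. hausdorff_pre d \<delta> (A n) + e * (1/2)^Suc n)"
    using le by (intro suminf_le) (auto intro: less_imp_le)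
  also have "\<dots> = (\<Sum>n. hausdorff_pre d \<delta> (A n)) + (\<Sum>n. ennreal e * ennreal ((1/2) ^ Suc n))"
    using \<open>0 < e\<close> by (subst suminf_add[symmetric])
       (auto simp del: ennreal_suminf_cmult simp add: ennreal_mult[symmetric])
  also have "(\<Sum>n. ennreal e * ennreal ((1/2) ^ Suc n)) = e"
    unfolding ennreal_suminf_cmult
    by (subst suminf_ennreal_eq[OF zero_le_power power_half_series]) auto
  finally show "hausdorff_pre d \<delta> (\<Union>n. A n) \<le> (\<Sum>n. hausdorff_pre d \<delta> (A n)) + e" .
qed

lemma hausdorff_outer_subadditive:
  "hausdorff_outer d (\<Union>i. A i) \<le> (\<Sum>i. hausdorff_outer d (A i))"
proof -
  have "hausdorff_pre d \<delta> (\<Union>i. A i) \<le> (\<Sum>i. hausdorff_outer d (A i))" if "\<delta> > 0" for \<delta>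
  proof -
    have "(\<Sum>i. hausdorff_pre d \<delta> (A i)) \<le> (\<Sum>i. hausdorff_outer d (A i))"
      unfolding hausdorff_outer_def using that by (intro suminf_le SUP_upper) auto
    then show ?thesis using hausdorff_pre_subadditive order_trans by blast
  qed
  then show ?thesis unfolding hausdorff_outer_def[of d "\<Union>i. A i"] by (intro SUP_least) auto
qed

lemma outer_measure_space_hausdorff: "outer_measure_space (Pow UNIV) (hausdorff_outer d)"
  using hausdorff_outer_mono hausdorff_outer_subadditive
  by (auto simp: outer_measure_space_def positive_def increasing_def countably_subadditive_def)

lemma hausdorff_outer_Un_le: "hausdorff_outer d (A \<union> B) \<le> hausdorff_outer d A + hausdorff_outer d B"
proof -
  interpret sigma_algebra UNIV "Pow UNIV :: 'a set set" by (rule sigma_algebra_Pow)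
  have "subadditive (Pow UNIV) (hausdorff_outer d :: 'a set \<Rightarrow> ennreal)"
    using outer_measure_space_hausdorff countably_subadditive_subadditive
    unfolding outer_measure_space_def by blast
  moreover have "A \<inter> (B - A) = {}" by blast
  ultimately have "hausdorff_outer d (A \<union> (B - A)) \<le> hausdorff_outer d A + hausdorff_outer d (B - A)"
    unfolding subadditive_def by blast
  also have "\<dots> \<le> hausdorff_outer d A + hausdorff_outer d B"
    by (intro add_left_mono hausdorff_outer_mono) auto
  finally show ?thesis by simp
qed

lemma diam_vol_mono: "bounded B \<Longrightarrow> A \<subseteq> B \<Longrightarrow> diam_vol d A \<le> diam_vol d B"
  unfolding diam_vol_def
  by (auto intro!: ennreal_leI mult_left_mono power_mono diameter_subset diameter_ge_0
      bounded_subset[of B] divide_right_mono)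

lemma hausdorff_outer_separated:
  fixes A B :: "'a::metric_space set"
  assumes r: "r > 0" and sep: "\<And>x y. x \<in> A \<Longrightarrow> y \<in> B \<Longrightarrow> dist x y \<ge> r"
  shows "hausdorff_outer d A + hausdorff_outer d B \<le> hausdorff_outer d (A \<union> B)"
proof -
  have main: "hausdorff_pre d \<delta> A + hausdorff_pre d \<delta> B \<le> hausdorff_pre d \<delta> (A \<union> B)"
    if "\<delta> < r" for \<delta>
    unfolding hausdorff_pre_def[of d \<delta> "A \<union> B"]
  proof (rule INF_greatest)
    fix C assume C: "C \<in> hausdorff_covers \<delta> (A \<union> B)"
    let ?CA = "\<lambda>i. if C i \<inter> A = {} then {} else C i"
    let ?CB = "\<lambda>i. if C i \<inter> A = {} then C i else {}"
    have small: "C i \<inter> B = {}" if "C i \<inter> A \<noteq> {}" for i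
    proof (rule ccontr)
      assume "C i \<inter> B \<noteq> {}"
      with that obtain x y where xy: "x \<in> C i" "x \<in> A" "y \<in> C i" "y \<in> B" by blast
      then have "dist x y \<le> diameter (C i)"
        using C by (auto simp: hausdorff_covers_def intro: diameter_bounded_bound)
      moreover have "diameter (C i) \<le> \<delta>" using C by (simp add: hausdorff_covers_def)
      ultimately show False using sep[of x y] xy \<open>\<delta> < r\<close> by linarith
    qed
    have b: "bounded (C i)" and dm: "diameter (C i) \<le> \<delta>" for i
      using C by (simp_all add: hausdorff_covers_def)
    have d0: "0 \<le> \<delta>" using diameter_ge_0[OF b[of 0]] dm[of 0] by linarith
    have "A \<subseteq> (\<Union>i. ?CA i)"
    proof
      fix x assume "x \<in> A"
      then obtain i where "x \<in> C i" using C by (fastforce simp: hausdorff_covers_def)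
      then have "x \<in> ?CA i" using \<open>x \<in> A\<close> by auto
      then show "x \<in> (\<Union>i. ?CA i)" by (rule UN_I[OF UNIV_I])
    qed
    moreover have "B \<subseteq> (\<Union>i. ?CB i)"
    proof
      fix x assume "x \<in> B"
      then obtain i where "x \<in> C i" using C by (fastforce simp: hausdorff_covers_def)
      then have "x \<in> ?CB i" using \<open>x \<in> B\<close> small[of i] by auto
      then show "x \<in> (\<Union>i. ?CB i)" by (rule UN_I[OF UNIV_I])
    qed
    ultimately have "?CA \<in> hausdorff_covers \<delta> A" "?CB \<in> hausdorff_covers \<delta> B"
      using b dm d0 by (simp_all add: hausdorff_covers_def)
    then have "hausdorff_pre d \<delta> A + hausdorff_pre d \<delta> B
        \<le> (\<Sum>i. diam_vol d (?CA i)) + (\<Sum>i. diam_vol d (?CB i))"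
      unfolding hausdorff_pre_def by (intro add_mono INF_lower)
    also have "\<dots> = (\<Sum>i. diam_vol d (?CA i) + diam_vol d (?CB i))"
      by (rule suminf_add) auto
    also have "\<dots> = (\<Sum>i. diam_vol d (C i))"
      by (intro suminf_cong) (simp add: diam_vol_def)
    finally show "hausdorff_pre d \<delta> A + hausdorff_pre d \<delta> B \<le> (\<Sum>i. diam_vol d (C i))" .
  qed
  have upper: "hausdorff_pre d \<delta> A + hausdorff_pre d \<delta>' B \<le> hausdorff_outer d (A \<union> B)"
    if "\<delta> > 0" "\<delta>' > 0" for \<delta> \<delta>'
  proof -
    define \<epsilon> where "\<epsilon> = min (min \<delta> \<delta>') (r / 2)"
    have "hausdorff_pre d \<delta> A + hausdorff_pre d \<delta>' B \<le> hausdorff_pre d \<epsilon> A + hausdorff_pre d \<epsilon> B"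
      by (intro add_mono hausdorff_pre_antimono) (auto simp: \<epsilon>_def)
    also have "\<dots> \<le> hausdorff_pre d \<epsilon> (A \<union> B)" using r by (intro main) (auto simp: \<epsilon>_def)
    also have "\<dots> \<le> hausdorff_outer d (A \<union> B)"
      unfolding hausdorff_outer_def using r that by (intro SUP_upper) (auto simp: \<epsilon>_def)
    finally show ?thesis .
  qed
  have "hausdorff_pre d \<delta> A + hausdorff_outer d B \<le> hausdorff_outer d (A \<union> B)" if "\<delta> > 0" for \<delta>
    unfolding hausdorff_outer_def[of d B] using upper[OF that]
    by (subst ennreal_SUP_add_right) (auto intro!: SUP_least)
  then show ?thesis
    unfolding hausdorff_outer_def[of d A]
    by (subst ennreal_SUP_add_left[symmetric]) (auto intro!: SUP_least)
qed

lemma closed_in_lambda_system_hausdorff: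
  fixes F :: "'a::metric_space set"
  assumes "closed F"
  shows "F \<in> lambda_system UNIV (Pow UNIV) (hausdorff_outer d)"
proof -
  let ?\<phi> = "hausdorff_outer d :: 'a set \<Rightarrow> ennreal"
  have le: "?\<phi> (A \<inter> F) + ?\<phi> (A - F) \<le> ?\<phi> A" for A
  proof (cases "F = {} \<or> ?\<phi> A = top")
    case True
    then show ?thesis by auto
  next
    case False
    then have ne: "F \<noteq> {}" and fin: "?\<phi> A < top" by (auto simp: less_top)
    define B where "B k = {x \<in> A. infdist x F \<ge> 1 / real (Suc k)}" for k
    define D where "D k = B (Suc k) - B k" for k
    have BA: "B k \<subseteq> A - F" for k
      using infdist_zero by (fastforce simp: B_def)
    have Bmono: "B k \<subseteq> B l" if "k \<le> l" for k l
    proof -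
      have "1 / real (Suc l) \<le> 1 / real (Suc k)" using that by (simp add: frac_le)
      then show ?thesis unfolding B_def by auto
    qed
    have Dadd: "?\<phi> (D (Suc k)) + ?\<phi> (B k) \<le> ?\<phi> (B (Suc (Suc k)))" for k
    proof -
      have "?\<phi> (D (Suc k)) + ?\<phi> (B k) \<le> ?\<phi> (D (Suc k) \<union> B k)"
      proof (rule hausdorff_outer_separated)
        show "1 / real (Suc k) - 1 / real (Suc (Suc k)) > 0"
          by (simp add: divide_strict_left_mono)
        fix x y assume "x \<in> D (Suc k)" "y \<in> B k"
        then have "infdist x F < 1 / real (Suc (Suc k))" "infdist y F \<ge> 1 / real (Suc k)"
          by (auto simp: D_def B_def)
        moreover have "infdist y F \<le> infdist x F + dist y x" by (rule infdist_triangle)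
        ultimately show "1 / real (Suc k) - 1 / real (Suc (Suc k)) \<le> dist x y"
          by (simp add: dist_commute)
      qed
      also have "\<dots> \<le> ?\<phi> (B (Suc (Suc k)))"
        using Bmono[of k "Suc (Suc k)"] by (intro hausdorff_outer_mono) (auto simp: D_def)
      finally show ?thesis .
    qed
    have odd_sum: "(\<Sum>k<n. ?\<phi> (D (Suc (2 * k)))) \<le> ?\<phi> (B (2 * n))" for n
    proof (induction n)
      case (Suc n)
      have "(\<Sum>k<Suc n. ?\<phi> (D (Suc (2 * k)))) \<le> ?\<phi> (B (2 * n)) + ?\<phi> (D (Suc (2 * n)))"
        using Suc.IH by (simp add: add_right_mono)
      also have "\<dots> \<le> ?\<phi> (B (2 * Suc n))" using Dadd[of "2 * n"] by (simp add: add.commute)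
      finally show ?case .
    qed simp
    have even_sum: "(\<Sum>k<n. ?\<phi> (D (Suc (Suc (2 * k))))) \<le> ?\<phi> (B (Suc (2 * n)))" for n
    proof (induction n)
      case (Suc n)
      have "(\<Sum>k<Suc n. ?\<phi> (D (Suc (Suc (2 * k))))) \<le> ?\<phi> (B (Suc (2 * n))) + ?\<phi> (D (Suc (Suc (2 * n))))"
        using Suc.IH by (simp add: add_right_mono)
      also have "\<dots> \<le> ?\<phi> (B (Suc (2 * Suc n)))" using Dadd[of "Suc (2 * n)"] by (simp add: add.commute)
      finally show ?case .
    qed simp
    have BleA: "?\<phi> (B k) \<le> ?\<phi> A" and DleA: "?\<phi> (D k) \<le> ?\<phi> A" for k
      using BA by (auto simp: D_def intro!: hausdorff_outer_mono)
    have part: "(\<Sum>k<Suc (2 * n). ?\<phi> (D k))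
        = ?\<phi> (D 0) + (\<Sum>k<n. ?\<phi> (D (Suc (2 * k)))) + (\<Sum>k<n. ?\<phi> (D (Suc (Suc (2 * k)))))" for n
      by (induction n) (simp_all add: algebra_simps)
    have "(\<Sum>k<n. ?\<phi> (D k)) \<le> ?\<phi> A + ?\<phi> A + ?\<phi> A" for n
    proof -
      have "(\<Sum>k<n. ?\<phi> (D k)) \<le> (\<Sum>k<Suc (2 * n). ?\<phi> (D k))"
        by (intro sum_mono2) auto
      also have "\<dots> \<le> ?\<phi> A + ?\<phi> A + ?\<phi> A"
        unfolding part
        by (intro add_mono DleA order_trans[OF odd_sum BleA] order_trans[OF even_sum BleA])
      finally show ?thesis .
    qed
    then have "(\<Sum>k. ?\<phi> (D k)) \<le> ?\<phi> A + ?\<phi> A + ?\<phi> A"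
      by (intro suminf_le_const summableI)
    then have Sfin: "(\<Sum>k. ?\<phi> (D k)) \<noteq> top"
      using fin by (auto simp: top_unique)
    have tail_eq: "(\<Sum>k. ?\<phi> (D (k + N))) = (\<Sum>k. ?\<phi> (D k)) - (\<Sum>k<N. ?\<phi> (D k))" for N
    proof -
      have s: "(\<Sum>k. ?\<phi> (D k)) = (\<Sum>k. ?\<phi> (D (k + N))) + (\<Sum>k<N. ?\<phi> (D k))"
        by (intro suminf_offset summableI)
      then have "(\<Sum>k<N. ?\<phi> (D k)) \<noteq> top" using Sfin by auto
      then show ?thesis unfolding s by simp
    qed
    have "(\<lambda>N. \<Sum>k<N. ?\<phi> (D k)) \<longlonglongrightarrow> (\<Sum>k. ?\<phi> (D k))"
      by (intro summable_LIMSEQ summableI)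
    then have "(\<lambda>N. (\<Sum>k. ?\<phi> (D k)) - (\<Sum>k<N. ?\<phi> (D k))) \<longlonglongrightarrow> (\<Sum>k. ?\<phi> (D k)) - (\<Sum>k. ?\<phi> (D k))"
      using Sfin by (intro tendsto_diff_ennreal tendsto_const) auto
    then have tail: "(\<lambda>N. \<Sum>k. ?\<phi> (D (k + N))) \<longlonglongrightarrow> 0"
      using Sfin unfolding tail_eq by simp
    have cover: "A - F \<subseteq> B N \<union> (\<Union>k. D (k + N))" for N
    proof
      fix x assume x: "x \<in> A - F"
      then have "infdist x F > 0"
        using assms ne in_closed_iff_infdist_zero[of F x] infdist_nonneg[of x F] by force
      then obtain m where "1 / real (Suc m) < infdist x F"
        using nat_approx_posE by blast
      then have "\<exists>m. x \<in> B m" using x by (auto simp: B_def intro: less_imp_le)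
      define m where "m = (LEAST m. x \<in> B m)"
      have xm: "x \<in> B m" unfolding m_def using \<open>\<exists>m. x \<in> B m\<close> by (rule LeastI_ex)
      show "x \<in> B N \<union> (\<Union>k. D (k + N))"
      proof (cases "m \<le> N")
        case True
        then show ?thesis using xm Bmono by blast
      next
        case False
        then obtain j where j: "m = Suc (j + N)"
          by (metis add.commute add_Suc_right less_imp_Suc_add not_le)
        then have "x \<notin> B (j + N)"
          unfolding m_def using not_less_Least[of "j + N" "\<lambda>m. x \<in> B m"] by simp
        then have "x \<in> D (j + N)" using xm j by (simp add: D_def)
        then show ?thesis by blast
      qed
    qed
    have step: "?\<phi> (A \<inter> F) + ?\<phi> (A - F) \<le> ?\<phi> A + (\<Sum>k. ?\<phi> (D (k + N)))" for N
    proof -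
      have "?\<phi> (A - F) \<le> ?\<phi> (B N) + ?\<phi> (\<Union>k. D (k + N))"
        using hausdorff_outer_mono[OF cover] hausdorff_outer_Un_le order_trans by blast
      also have "\<dots> \<le> ?\<phi> (B N) + (\<Sum>k. ?\<phi> (D (k + N)))"
        by (intro add_left_mono hausdorff_outer_subadditive)
      finally have "?\<phi> (A \<inter> F) + ?\<phi> (A - F) \<le> (?\<phi> (A \<inter> F) + ?\<phi> (B N)) + (\<Sum>k. ?\<phi> (D (k + N)))"
        by (simp add: add_left_mono add.assoc)
      also have "?\<phi> (A \<inter> F) + ?\<phi> (B N) \<le> ?\<phi> ((A \<inter> F) \<union> B N)"
      proof (rule hausdorff_outer_separated)
        show "1 / real (Suc N) > 0" by simp
        fix x y assume "x \<in> A \<inter> F" "y \<in> B N"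
        then show "1 / real (Suc N) \<le> dist x y"
          using infdist_le[of x F y] by (auto simp: B_def dist_commute)
      qed
      also have "?\<phi> ((A \<inter> F) \<union> B N) \<le> ?\<phi> A"
        using BA by (intro hausdorff_outer_mono) auto
      finally show ?thesis by (simp add: add_right_mono)
    qed
    have "(\<lambda>N. ?\<phi> A + (\<Sum>k. ?\<phi> (D (k + N)))) \<longlonglongrightarrow> ?\<phi> A + 0"
      by (intro tendsto_add tendsto_const tail)
    then show ?thesis using LIMSEQ_le_const[of _ "?\<phi> A"] step by auto
  qed
  have "?\<phi> (F \<inter> A) + ?\<phi> ((UNIV - F) \<inter> A) = ?\<phi> A" for A
  proof (rule antisym)
    show "?\<phi> (F \<inter> A) + ?\<phi> ((UNIV - F) \<inter> A) \<le> ?\<phi> A"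
      using le[of A] by (simp add: Int_commute Diff_eq)
    have "A = (F \<inter> A) \<union> ((UNIV - F) \<inter> A)" by blast
    then show "?\<phi> A \<le> ?\<phi> (F \<inter> A) + ?\<phi> ((UNIV - F) \<inter> A)"
      using hausdorff_outer_Un_le by metis
  qed
  then show ?thesis by (simp add: lambda_system_def)
qed

lemma emeasure_hausdorff_measure:
  fixes A :: "'a::metric_space set"
  assumes "A \<in> sets borel"
  shows "emeasure (hausdorff_measure d) A = hausdorff_outer d A"
proof -
  interpret P: sigma_algebra UNIV "Pow UNIV :: 'a set set" by (rule sigma_algebra_Pow)
  let ?L = "lambda_system UNIV (Pow UNIV) (hausdorff_outer d :: 'a set \<Rightarrow> ennreal)"
  have L: "measure_space UNIV ?L (hausdorff_outer d)"
    by (rule P.caratheodory_lemma[OF outer_measure_space_hausdorff])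
  then interpret L: sigma_algebra UNIV ?L by (simp add: measure_space_def)
  have "sets (borel :: 'a measure) \<subseteq> ?L"
    unfolding borel_eq_closed using closed_in_lambda_system_hausdorff
    by (subst sets_measure_of) (blast intro!: L.sigma_sets_subset)+
  moreover have "countably_additive ?L (hausdorff_outer d)"
    using L by (simp add: measure_space_def)
  ultimately have "countably_additive (sets borel) (hausdorff_outer d :: 'a set \<Rightarrow> ennreal)"
    unfolding countably_additive_def by blast
  moreover have "positive (sets borel) (hausdorff_outer d :: 'a set \<Rightarrow> ennreal)"
    by (simp add: positive_def)
  moreover have "sigma_algebra UNIV (sets (borel :: 'a measure))"
    using sets.sigma_algebra_axioms[of "borel :: 'a measure"] by simp
  ultimately show ?thesis
    unfolding hausdorff_measure_def using assms by (intro emeasure_measure_of_sigma)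
qed

section \<open>Regular polytopes and their symmetries\<close>

definition flag_of :: "(nat \<Rightarrow> 'a::euclidean_space set) \<Rightarrow> 'a set \<Rightarrow> bool" where
  "flag_of F T \<longleftrightarrow>
     (\<forall>i<DIM('a). F i face_of T \<and> aff_dim (F i) = int i) \<and>
     (\<forall>i. Suc i < DIM('a) \<longrightarrow> F i \<subseteq> F (Suc i))"

definition regular_polytope :: "'a::euclidean_space set \<Rightarrow> bool" where
  "regular_polytope T \<longleftrightarrow>
     polytope T \<and> aff_dim T = int DIM('a) \<and>
     (\<forall>F G. flag_of F T \<and> flag_of G T \<longrightarrow>
        (\<exists>g. (\<forall>x y. dist (g x) (g y) = dist x y) \<and> g ` T = T \<and> (\<forall>i<DIM('a). g ` F i = G i)))"

text \<open>The centre of a regular polytope is the centroid of its vertices.\<close>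

definition centered_at_origin :: "'a::euclidean_space set \<Rightarrow> bool" where
  "centered_at_origin T \<longleftrightarrow> (\<Sum>v | v extreme_point_of T. v) = 0"

definition symmetry_group :: "'a::euclidean_space set \<Rightarrow> ('a \<Rightarrow> 'a) set" where
  "symmetry_group T = {g. orthogonal_transformation g \<and> g ` T = T}"

section \<open>Convex bodies\<close>

definition convex_body :: "'a::euclidean_space set \<Rightarrow> bool" where
  "convex_body K \<longleftrightarrow> convex K \<and> compact K \<and> interior K \<noteq> {}"

definition support_fun :: "'a::euclidean_space set \<Rightarrow> 'a \<Rightarrow> real" where
  "support_fun K x = (SUP z\<in>K. z \<bullet> x)"

definition strongly_symmetric_bodies :: "'a::euclidean_space set \<Rightarrow> 'a set set" where
  "strongly_symmetric_bodies T =
     {K. convex_body K \<and>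
         (\<forall>g\<in>symmetry_group T. \<forall>x\<in>sphere 0 1. support_fun K (g x) = support_fun K x)}"

section \<open>Calculus on the unit sphere\<close>

text \<open>
  Functions and vector fields on the sphere are differentiated after extending them to
  the complement of the origin by \<open>y \<mapsto> f (y / |y|)\<close>; note that \<^term>\<open>sgn y\<close> is \<open>y / |y|\<close>.
  Derivatives in tangent directions do not depend on the extension, and the radial derivative
  of this one vanishes, so its Euclidean gradient at a point of the sphere is the intrinsic gradient.
\<close>

definition C2_on :: "'a::euclidean_space set \<Rightarrow> ('a \<Rightarrow> real) \<Rightarrow> bool" where
  "C2_on U F \<longleftrightarrow>
     (\<exists>(F' :: 'a \<Rightarrow> 'a \<Rightarrow>\<^sub>L real) (F'' :: 'a \<Rightarrow> 'a \<Rightarrow>\<^sub>L 'a \<Rightarrow>\<^sub>L real).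
        (\<forall>x\<in>U. (F has_derivative blinfun_apply (F' x)) (at x) \<and>
               (F' has_derivative blinfun_apply (F'' x)) (at x)) \<and>
        continuous_on U F'')"

definition C2_on_sphere :: "('a::euclidean_space \<Rightarrow> real) \<Rightarrow> bool" where
  "C2_on_sphere f \<longleftrightarrow> C2_on (- {0}) (\<lambda>y. f (sgn y))"

definition sphere_grad :: "('a::euclidean_space \<Rightarrow> real) \<Rightarrow> 'a \<Rightarrow> 'a" where
  "sphere_grad f x = (\<Sum>b\<in>Basis. frechet_derivative (\<lambda>y. f (sgn y)) (at x) b *\<^sub>R b)"

text \<open>
  \<open>\<nabla>\<^sup>2 f (u, v) = \<langle>\<nabla>\<^sub>u grad f, v\<rangle>\<close> for \<open>u\<close>, \<open>v\<close> tangent at \<open>x\<close>. The Levi-Civita connection of the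
  round metric is the tangential part of the ambient directional derivative; the projection is
  omitted because \<open>v\<close> is tangent.
\<close>

definition sphere_hessian :: "('a::euclidean_space \<Rightarrow> real) \<Rightarrow> 'a \<Rightarrow> 'a \<Rightarrow> 'a \<Rightarrow> real" where
  "sphere_hessian f x u v = frechet_derivative (\<lambda>y. sphere_grad f (sgn y)) (at x) u \<bullet> v"

text \<open>
  From here on \<open>n\<close> is \<open>CARD('n)\<close>, and \<open>\<real>\<^bsup>n+1\<^esup>\<close> is \<^typ>\<open>real ^ ('n option)\<close>: this makes a frame of the
  tangent space an \<^typ>\<open>'n\<close>-indexed family and the Hessian in it an \<open>n \<times> n\<close> matrix.
\<close>

definition tangent_frame :: "real ^ ('n::finite option) \<Rightarrow> ('n \<Rightarrow> real ^ ('n option)) \<Rightarrow> bool" where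
  "tangent_frame x e \<longleftrightarrow>
     (\<forall>i. e i \<bullet> x = 0) \<and> (\<forall>i j. e i \<bullet> e j = (if i = j then 1 else 0))"

lemma ex_tangent_frame:
  fixes x :: "real ^ ('n::finite option)"
  assumes "x \<noteq> 0"
  shows "\<exists>e :: 'n \<Rightarrow> real ^ ('n option). tangent_frame x e"
proof -
  let ?S = "{y. x \<bullet> y = 0}"
  obtain B where B: "B \<subseteq> ?S" "pairwise orthogonal B" "\<And>b. b \<in> B \<Longrightarrow> norm b = 1"
      "independent B" "card B = dim ?S"
    using orthonormal_basis_subspace[OF subspace_hyperplane[of x]] by metis
  have "dim ?S = CARD('n)" using dim_hyperplane[OF assms] by simp
  then have "card B = card (UNIV :: 'n set)" using B by simp
  moreover have "finite B" using B independent_imp_finite by blast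
  ultimately obtain e where e: "bij_betw e (UNIV :: 'n set) B"
    by (metis finite_same_card_bij finite)
  have "e i \<in> B" for i using e by (auto simp: bij_betw_def)
  moreover have "e i \<noteq> e j" if "i \<noteq> j" for i j using e that by (auto simp: bij_betw_def inj_def)
  moreover have "e i \<bullet> x = 0" for i using B(1) \<open>e i \<in> B\<close> by (auto simp: inner_commute)
  ultimately show ?thesis using B(2,3)
    by (intro exI[of _ e]) (auto simp: tangent_frame_def pairwise_def orthogonal_def norm_eq_1)
qed

text \<open>\<open>det (\<nabla>\<^sup>2 h + h I)\<close> at \<open>x\<close>; the value does not depend on the orthonormal frame chosen.\<close>

definition det_hessian :: "(real ^ ('n::finite option) \<Rightarrow> real) \<Rightarrow> real ^ ('n option) \<Rightarrow> real" where
  "det_hessian h x =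
     (let e = (SOME e. tangent_frame x e)
      in det ((\<chi> i j. sphere_hessian h x (e i) (e j)) + h x *\<^sub>R (mat 1 :: real ^ 'n ^ 'n)))"

definition sphere_measure :: "(real ^ ('n::finite option)) measure" where
  "sphere_measure = restrict_space (hausdorff_measure CARD('n)) (sphere 0 1)"

text \<open>
  \<open>dV\<^sub>K = h\<^sub>K det (\<nabla>\<^sup>2 h\<^sub>K + h\<^sub>K I) d\<sigma>\<close>. The matrix is positive semidefinite for a
  \<open>C\<^sup>2\<close> support function, so \<^const>\<open>ennreal\<close> truncates nothing when \<open>h\<^sub>K > 0\<close>.
\<close>

definition cone_volume :: "(real ^ ('n::finite option)) set \<Rightarrow> (real ^ ('n option)) measure" where
  "cone_volume K =
     density sphere_measure (\<lambda>x. ennreal (support_fun K x * det_hessian (support_fun K) x))"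

end

theory Submission
  imports Defs
begin

text \<open>
  The form \<open>B u v = \<integral> (u \<bullet> x) (v \<bullet> x) / h\<^sub>K\<^sup>2 dV\<^sub>K\<close> is invariant under the symmetry group of \<open>T\<close>, since
  \<open>dV\<^sub>K\<close> and \<open>h\<^sub>K\<close> are. Every invariant bilinear form is a multiple of the inner product: let \<open>F\<close>
  be a facet and \<open>a\<close> its normal, scaled so that \<open>a \<bullet> x = 1\<close> on \<open>F\<close>. The stabiliser of \<open>F\<close> fixes
  \<open>a\<close> and is transitive on the vertices of \<open>F\<close>, so \<open>B a\<close> is constant on these vertices; as they
  span the space, \<open>B a = c (a \<bullet> _)\<close>. All facets are equivalent, so \<open>c\<close> does not depend on \<open>F\<close>, and
  the facet normals span. Finally, the trace of \<open>B\<close> is \<open>\<integral> 1 / h\<^sub>K\<^sup>2 dV\<^sub>K\<close> because \<open>|x| = 1\<close>.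
\<close>

section \<open>Symmetries of regular polytopes\<close>

lemma polytope_eq_convex_hull_extreme:
  fixes S :: "'a::euclidean_space set"
  assumes "polytope S"
  shows "S = convex hull {v. v extreme_point_of S}"
  using assms by (intro Krein_Milman_Minkowski polytope_imp_compact polytope_imp_convex)

lemma finite_extreme_points_polytope:
  fixes S :: "'a::euclidean_space set"
  assumes "polytope S"
  shows "finite {v. v extreme_point_of S}"
  using assms by (intro finite_polyhedron_extreme_points polytope_imp_polyhedron)

text \<open>Subtracting \<open>g 0\<close> leaves an isometry that fixes the origin, and such a map
  of a Euclidean space is automatically linear.\<close>

lemma isometry_affine:
  fixes g :: "'a::euclidean_space \<Rightarrow> 'a"
  assumes "\<And>x y. dist (g x) (g y) = dist x y"
  obtains A where "orthogonal_transformation A" "g = (\<lambda>x. g 0 + A x)"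
proof
  show "orthogonal_transformation (\<lambda>x. g x - g 0)"
    unfolding orthogonal_transformation_isometry using assms by (simp add: dist_norm)
qed auto

text \<open>Extreme points are singleton faces, and both translations and injective linear maps
  carry faces to faces.\<close>

lemma extreme_points_isometry_image:
  fixes g :: "'a::euclidean_space \<Rightarrow> 'a"
  assumes "\<And>x y. dist (g x) (g y) = dist x y"
  shows "{v. v extreme_point_of g ` T} = g ` {v. v extreme_point_of T}"
proof -
  obtain A where A: "orthogonal_transformation A" "g = (\<lambda>x. g 0 + A x)"
    using isometry_affine[OF assms] by blast
  have im: "g ` S = (+) (g 0) ` A ` S" for S
    by (subst A(2)) (simp add: image_image)
  have "g ` {v} face_of g ` T \<longleftrightarrow> {v} face_of T" for v
    unfolding im face_of_translation_eq
    using A(1) by (intro face_of_linear_image orthogonal_transformation_linear orthogonal_transformation_inj)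
  then have "g v extreme_point_of g ` T \<longleftrightarrow> v extreme_point_of T" for v
    by (simp add: face_of_singleton)
  moreover have "v \<in> g ` T" if "v extreme_point_of g ` T" for v
    using that by (simp add: extreme_point_of_def)
  ultimately show ?thesis by blast
qed

lemma polytope_extreme_point_exists:
  fixes T :: "'a::euclidean_space set"
  assumes "polytope T" "T \<noteq> {}"
  obtains v where "v extreme_point_of T"
  using polytope_eq_convex_hull_extreme[OF assms(1)] assms(2) by fastforce

text \<open>An isometry preserving the polytope permutes its vertices, hence fixes their centroid.\<close>

lemma isometry_in_symmetry_group:
  fixes T :: "'a::euclidean_space set"
  assumes "polytope T" "T \<noteq> {}" "centered_at_origin T"
    and iso: "\<And>x y. dist (g x) (g y) = dist x y" and gT: "g ` T = T"
  shows "g \<in> symmetry_group T"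
proof -
  let ?V = "{v. v extreme_point_of T}"
  obtain A where A: "orthogonal_transformation A" "g = (\<lambda>x. g 0 + A x)"
    using isometry_affine[OF iso] by blast
  have "inj g" using iso by (metis dist_eq_0_iff injI)
  have fin: "finite ?V" by (rule finite_extreme_points_polytope[OF assms(1)])
  have "?V \<noteq> {}" using polytope_extreme_point_exists assms by blast
  have sum0: "(\<Sum>v\<in>?V. v) = 0" using assms(3) by (simp add: centered_at_origin_def)
  have "(\<Sum>v\<in>?V. v) = (\<Sum>v\<in>g ` ?V. v)"
    using extreme_points_isometry_image[OF iso, of T] gT by simp
  also have "\<dots> = (\<Sum>v\<in>?V. g v)"
    using \<open>inj g\<close> by (subst sum.reindex) (auto intro: inj_on_subset)
  also have "\<dots> = real (card ?V) *\<^sub>R g 0 + A (\<Sum>v\<in>?V. v)"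
    by (subst A(2)) (simp add: sum.distrib scaleR_conv_of_real sum_constant_scaleR
      linear_sum[OF orthogonal_transformation_linear[OF A(1)]])
  \<comment> \<open>The vertices sum to zero, so the linear part contributes nothing and only the
    translation part of \<open>g\<close> is left.\<close>
  finally have "real (card ?V) *\<^sub>R g 0 = 0"
    using A(1) by (simp add: sum0 linear_0 orthogonal_transformation_linear)
  moreover have "card ?V \<noteq> 0" using fin \<open>?V \<noteq> {}\<close> by (simp only: card_eq_0_iff) simp
  ultimately have "g 0 = 0" by simp
  then show ?thesis
    using iso gT by (simp add: symmetry_group_def orthogonal_transformation_isometry)
qed

section \<open>Flags and transitivity on incident vertex-facet pairs\<close>

text \<open>Induction on the dimension: \<open>v\<close> lies in some facet of \<open>P\<close>, a
  chain inside that facet exists by induction, and \<open>P\<close> is appended on top.\<close>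

lemma ex_face_chain:
  fixes P :: "'a::euclidean_space set"
  assumes "polytope P" "v extreme_point_of P" "aff_dim P = int d"
  shows "\<exists>F. F 0 = {v} \<and> F d = P \<and> (\<forall>i\<le>d. F i face_of P \<and> aff_dim (F i) = int i) \<and>
             (\<forall>i<d. F i \<subseteq> F (Suc i))"
  using assms
proof (induction d arbitrary: P)
  case 0
  then have "P = {v}"
    by (metis aff_dim_eq_0 extreme_point_of_def of_nat_0 singletonD)
  then show ?case by (intro exI[of _ "\<lambda>_. {v}"]) (auto simp: face_of_refl)
next
  case (Suc d)
  have "{v} face_of P" using Suc.prems(2) by (simp add: face_of_singleton)
  moreover have "{v} \<noteq> P"
    using Suc.prems(3) by (metis aff_dim_sing of_nat_0 of_nat_eq_iff old.nat.distinct(2))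
  ultimately obtain Q where Q: "Q facet_of P" "v \<in> Q"
    using face_of_polyhedron_subset_facet polytope_imp_polyhedron[OF Suc.prems(1)]
    by (metis empty_not_insert insert_subset)
  then have face: "Q face_of P" and dimQ: "aff_dim Q = int d"
    using Suc.prems(3) by (auto simp: facet_of_def)
  then have "polytope Q" "v extreme_point_of Q"
    using Suc.prems Q face_of_polytope_polytope extreme_point_of_face by blast+
  then obtain F where F: "F 0 = {v}" "F d = Q" "\<forall>i\<le>d. F i face_of Q \<and> aff_dim (F i) = int i"
    "\<forall>i<d. F i \<subseteq> F (Suc i)"
    using Suc.IH dimQ by blast
  have "(F(Suc d := P)) i face_of P \<and> aff_dim ((F(Suc d := P)) i) = int i" if "i \<le> Suc d" for i
    using that F(3) face Suc.prems
    by (auto simp: le_Suc_eq polytope_imp_convex face_of_refl intro: face_of_trans)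
  moreover have "(F(Suc d := P)) i \<subseteq> (F(Suc d := P)) (Suc i)" if "i < Suc d" for i
    using that F face by (auto simp: less_Suc_eq dest: face_of_imp_subset)
  ultimately show ?case using F(1) by (intro exI[of _ "F(Suc d := P)"]) auto
qed

text \<open>Each incident vertex-facet pair extends to a flag. Regularity maps one flag to the other
  by an isometry preserving \<open>T\<close>, which is a symmetry because it fixes the
  centroid.\<close>

lemma regular_polytope_transitive:
  fixes T :: "'a::euclidean_space set"
  assumes "regular_polytope T" "centered_at_origin T"
    and "F facet_of T" "v extreme_point_of F" "F' facet_of T" "v' extreme_point_of F'"
  obtains g where "g \<in> symmetry_group T" "g ` F = F'" "g v = v'"
proof -
  have T: "polytope T" "aff_dim T = int DIM('a)"
    using assms(1) by (auto simp: regular_polytope_def)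
  \<comment> \<open>A flag lists the proper faces of dimensions 0 to \<open>DIM('a) - 1\<close>, so
    a chain in \<open>G\<close> that ends with \<open>G\<close> itself is already a full flag of
    \<open>T\<close>.\<close>
  have flag: "\<exists>\<Phi>. flag_of \<Phi> T \<and> \<Phi> 0 = {w} \<and> \<Phi> (DIM('a) - 1) = G"
    if G: "G facet_of T" and w: "w extreme_point_of G" for G w
  proof -
    have "aff_dim G = int (DIM('a) - 1)" "G face_of T"
      using G T by (auto simp: facet_of_def of_nat_diff)
    moreover have "polytope G" using T \<open>G face_of T\<close> face_of_polytope_polytope by blast
    ultimately obtain \<Phi> where \<Phi>: "\<Phi> 0 = {w}" "\<Phi> (DIM('a) - 1) = G"
      "\<forall>i\<le>DIM('a) - 1. \<Phi> i face_of G \<and> aff_dim (\<Phi> i) = int i" "\<forall>i<DIM('a) - 1. \<Phi> i \<subseteq> \<Phi> (Suc i)"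
      using ex_face_chain[OF _ w] by blast
    then have "flag_of \<Phi> T"
      unfolding flag_of_def using face_of_trans[OF _ \<open>G face_of T\<close>] by (simp add: less_diff_conv)
    then show ?thesis using \<Phi> by blast
  qed
  obtain \<Phi> \<Phi>' where \<Phi>: "flag_of \<Phi> T" "\<Phi> 0 = {v}" "\<Phi> (DIM('a) - 1) = F"
    and \<Phi>': "flag_of \<Phi>' T" "\<Phi>' 0 = {v'}" "\<Phi>' (DIM('a) - 1) = F'"
    using flag assms by meson
  obtain g where g: "\<forall>x y. dist (g x) (g y) = dist x y" "g ` T = T" "\<forall>i<DIM('a). g ` \<Phi> i = \<Phi>' i"
    using assms(1) \<Phi>(1) \<Phi>'(1) unfolding regular_polytope_def by blast
  have "g ` F = F'" using g(3) \<Phi>(3) \<Phi>'(3) by (metis DIM_positive diff_less zero_less_one)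
  moreover have "g v = v'" using g(3) \<Phi>(2) \<Phi>'(2) DIM_positive[where 'a='a]
    by (metis image_empty image_insert the_elem_eq)
  moreover have "T \<noteq> {}" using T(2) by auto
  ultimately show ?thesis
    using that isometry_in_symmetry_group[OF T(1) _ assms(2)] g by blast
qed

section \<open>Facet normals and invariant bilinear forms\<close>

text \<open>Otherwise a hyperplane through 0 has all vertices weakly on one side. As they sum to
  zero, they all lie on it, against full dimension.\<close>

lemma centered_polytope_0_in_interior:
  fixes T :: "'a::euclidean_space set"
  assumes "polytope T" "aff_dim T = int DIM('a)" "centered_at_origin T"
  shows "0 \<in> interior T"
proof (rule ccontr)
  let ?V = "{v. v extreme_point_of T}"
  assume "0 \<notin> interior T"
  moreover have conv: "convex T" by (rule polytope_imp_convex[OF assms(1)])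
  ultimately obtain a where a: "a \<noteq> 0" "\<forall>x\<in>interior T. 0 \<le> a \<bullet> x"
    using separating_hyperplane_set_0 convex_interior by metis
  have "T \<noteq> {}" using assms(2) by auto
  then have "interior T \<noteq> {}"
    using assms(2) conv by (simp add: interior_rel_interior_gen rel_interior_eq_empty)
  \<comment> \<open>The separation bounds only the interior; its closure contains \<open>T\<close>,
    so the bound reaches the vertices.\<close>
  then have "T \<subseteq> closure (interior T)"
    using closure_subset convex_closure_interior[OF conv] by blast
  also have "\<dots> \<subseteq> {x. 0 \<le> a \<bullet> x}"
    using a(2) by (intro closure_minimal closed_halfspace_ge) (auto simp: closed_halfspace_component_ge)
  finally have nonneg: "\<forall>v\<in>?V. 0 \<le> a \<bullet> v" by (auto simp: extreme_point_of_def)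
  have "(\<Sum>v\<in>?V. a \<bullet> v) = 0"
    using assms(3) by (simp add: centered_at_origin_def flip: inner_sum_right)
  then have "\<forall>v\<in>?V. a \<bullet> v = 0"
    using nonneg finite_extreme_points_polytope[OF assms(1)] by (subst (asm) sum_nonneg_eq_0_iff) auto
  then have "convex hull ?V \<subseteq> {x. a \<bullet> x = 0}"
    by (intro hull_minimal convex_hyperplane) auto
  then have "T \<subseteq> {x. a \<bullet> x = 0}"
    using polytope_eq_convex_hull_extreme[OF assms(1)] by simp
  then have "aff_dim T \<le> aff_dim {x. a \<bullet> x = 0}" by (rule aff_dim_subset)
  then show False using a(1) assms(2) by simp
qed

text \<open>The interior point 0 lies strictly inside the supporting half-space of \<open>F\<close>,
  so the offset \<open>b\<close> is positive and can be scaled to 1.\<close>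

lemma facet_normal:
  fixes T :: "'a::euclidean_space set"
  assumes T: "polytope T" and int0: "0 \<in> interior T" and F: "F facet_of T"
  obtains a where "\<And>x. x \<in> F \<Longrightarrow> a \<bullet> x = 1"
proof -
  have face: "F face_of T" "F \<noteq> {}" "F \<noteq> T" using F facet_of_irrefl by (auto simp: facet_of_def)
  have poly: "polyhedron T" by (rule polytope_imp_polyhedron[OF T])
  then have "F exposed_face_of T" using face exposed_face_of_polyhedron by blast
  then obtain a b where ab: "a \<noteq> 0" "T \<subseteq> {x. a \<bullet> x \<le> b}" "F = T \<inter> {x. a \<bullet> x = b}"
    using face by (auto simp: exposed_face_of)
  have "0 \<in> interior {x. a \<bullet> x \<le> b}" using int0 interior_mono[OF ab(2)] by blast
  then have "b > 0" using ab(1) by (simp add: interior_halfspace_le)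
  then show ?thesis using ab(3) by (intro that[of "a /\<^sub>R b"]) auto
qed

text \<open>The affine hull of a facet has codimension 1 and misses the origin, so adjoining 0
  raises the dimension to that of the whole space.\<close>

lemma span_extreme_points_facet:
  fixes T :: "'a::euclidean_space set"
  assumes T: "polytope T" "0 \<in> interior T" and F: "F facet_of T"
  shows "span {v. v extreme_point_of F} = UNIV"
proof -
  let ?V = "{v. v extreme_point_of F}"
  obtain a where a: "\<And>x. x \<in> F \<Longrightarrow> a \<bullet> x = 1" using facet_normal[OF assms] by blast
  have "aff_dim T = int DIM('a)" using T(2) by (intro aff_dim_nonempty_interior) auto
  then have "aff_dim F = int DIM('a) - 1" using F by (simp add: facet_of_def)
  have "polytope F" using T(1) F face_of_polytope_polytope facet_of_imp_face_of by blast
  then have hull: "affine hull F = affine hull ?V"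
    using polytope_eq_convex_hull_extreme by (metis affine_hull_convex_hull)
  have "affine hull F \<subseteq> {x. a \<bullet> x = 1}"
    by (intro hull_minimal affine_hyperplane) (use a in auto)
  then have "0 \<notin> affine hull F" by auto
  then have "int (dim ?V) = aff_dim ?V + 1"
    using aff_dim_zero[of "insert 0 ?V"] hull by (simp add: aff_dim_insert hull_inc dim_insert span_zero)
  also have "aff_dim ?V = aff_dim F" by (metis hull aff_dim_affine_hull)
  finally have "dim ?V = DIM('a)" using \<open>aff_dim F = _\<close> by simp
  then show ?thesis using dim_eq_full by blast
qed

text \<open>A vector orthogonal to all facet normals spans a line missing every facet, so the ray along
  it would never leave the polytope.\<close>

lemma span_facet_normals:
  fixes T :: "'a::euclidean_space set"
  assumes T: "polytope T" "0 \<in> interior T"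
  shows "span {a. \<exists>F. F facet_of T \<and> (\<forall>x\<in>F. a \<bullet> x = 1)} = UNIV" (is "span ?A = _")
proof (rule ccontr)
  assume "span ?A \<noteq> UNIV"
  then obtain u where u: "u \<noteq> 0" "\<forall>x\<in>span ?A. u \<bullet> x = 0"
    using span_not_univ_subset_hyperplane[of ?A] by auto
  have "bounded T" by (rule polytope_imp_bounded[OF T(1)])
  then obtain t where t: "0 < t" "0 + t *\<^sub>R u \<in> frontier T"
    using ray_to_frontier[OF _ T(2) u(1)] by metis
  have "frontier T = rel_frontier T" using T(2) by (metis empty_iff rel_frontier_nonempty_interior)
  then obtain F where F: "F facet_of T" "t *\<^sub>R u \<in> F"
    using t rel_frontier_of_polyhedron[OF polytope_imp_polyhedron[OF T(1)]] by auto
  obtain a where a: "\<And>x. x \<in> F \<Longrightarrow> a \<bullet> x = 1" using facet_normal[OF T F(1)] by blast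
  then have "u \<bullet> a = 0" using u(2) F(1) by (blast intro: span_base)
  then show False using a[OF F(2)] by (simp add: inner_commute)
qed

text \<open>The constant is read off at one incident pair, \<open>c = B a0 v0\<close>. Transitivity
  on incident pairs makes it the same for all vertices of a facet and for all facets at
  once.\<close>

lemma invariant_bilinear_form:
  fixes T :: "'a::euclidean_space set" and B :: "'a \<Rightarrow> 'a \<Rightarrow> real"
  assumes T: "regular_polytope T" "centered_at_origin T" and B: "bilinear B"
    and inv: "\<And>g u v. g \<in> symmetry_group T \<Longrightarrow> B (g u) (g v) = B u v"
  obtains c where "\<And>u v. B u v = c * (u \<bullet> v)"
proof -
  have poly: "polytope T" "aff_dim T = int DIM('a)"
    using T(1) by (auto simp: regular_polytope_def)
  have int0: "0 \<in> interior T" using centered_polytope_0_in_interior poly T(2) by blast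
  have ex: "\<exists>v. v extreme_point_of F" if "F facet_of T" for F
    using that poly(1) polytope_extreme_point_exists[of F] face_of_polytope_polytope
    unfolding facet_of_def by metis
  obtain F0 where F0: "F0 facet_of T" using polytope_facet_exists[OF poly(1)] poly(2) by auto
  obtain v0 where v0: "v0 extreme_point_of F0" using ex F0 by blast
  obtain a0 where a0: "\<And>x. x \<in> F0 \<Longrightarrow> a0 \<bullet> x = 1" using facet_normal[OF poly(1) int0 F0] by blast
  have on_vertices: "B a v = B a0 v0 * (a \<bullet> v)"
    if F: "F facet_of T" and a: "\<forall>x\<in>F. a \<bullet> x = 1" and v: "v extreme_point_of F" for F a v
  proof -
    obtain g where g: "g \<in> symmetry_group T" "g ` F0 = F" "g v0 = v"
      using regular_polytope_transitive[OF T F0 v0 F v] by blast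
    have orth: "orthogonal_transformation g" using g(1) by (simp add: symmetry_group_def)
    \<comment> \<open>Both \<open>a\<close> and \<open>g a0\<close> pair to 1 with every vertex of
      \<open>F\<close>. These vertices span, hence \<open>a = g a0\<close>.\<close>
    have "(a - g a0) \<bullet> w = 0" if "w extreme_point_of F" for w
    proof -
      have "w \<in> F" using that by (simp add: extreme_point_of_def)
      moreover obtain x where "x \<in> F0" "w = g x" using g(2) \<open>w \<in> F\<close> by auto
      moreover have "g a0 \<bullet> g x = a0 \<bullet> x" using orth by (simp add: orthogonal_transformation_def)
      ultimately show ?thesis using a a0 by (simp add: inner_diff_left)
    qed
    then have "(a - g a0) \<bullet> w = 0" if "w \<in> span {w. w extreme_point_of F}" for w
      using that by (intro orthogonal_to_span[of w "{w. w extreme_point_of F}" "a - g a0", unfolded orthogonal_def]) auto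
    then have "a = g a0"
      unfolding span_extreme_points_facet[OF poly(1) int0 F] by (metis UNIV_I eq_iff_diff_eq_0 inner_eq_zero_iff)
    moreover have "a \<bullet> v = 1" using a v by (simp add: extreme_point_of_def)
    ultimately show ?thesis using inv[OF g(1), of a0 v0] g(3) by simp
  qed
  have lin: "linear (B a)" "linear (\<lambda>v. c * (a \<bullet> v))" "linear (\<lambda>a. B a v)" "linear (\<lambda>a. c * (a \<bullet> v))" for a v c
    using B by (auto simp: bilinear_def linear_iff algebra_simps)
  \<comment> \<open>Linearity in the second argument extends the identity from the vertices of
    \<open>F\<close> to all \<open>v\<close>; linearity in the first then extends it from the facet
    normals to all \<open>u\<close>.\<close>
  have on_normals: "B a v = B a0 v0 * (a \<bullet> v)"
    if "F facet_of T" "\<forall>x\<in>F. a \<bullet> x = 1" for F a v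
    using on_vertices[OF that] span_extreme_points_facet[OF poly(1) int0 that(1)]
    by (intro linear_eq_on[OF lin(1,2), of v "{v. v extreme_point_of F}"]) auto
  have "B u v = B a0 v0 * (u \<bullet> v)" for u v
    using on_normals span_facet_normals[OF poly(1) int0]
    by (intro linear_eq_on[OF lin(3,4), of u "{a. \<exists>F. F facet_of T \<and> (\<forall>x\<in>F. a \<bullet> x = 1)}"]) auto
  then show ?thesis by (rule that)
qed

section \<open>Hausdorff measure of the sphere\<close>

lemma diameter_isometry_image:
  assumes "\<And>x y. dist (f x) (f y) = dist x y"
  shows "diameter (f ` S) = diameter S"
proof -
  have "(\<lambda>(x, y). dist x y) ` (f ` S \<times> f ` S) = (\<lambda>(x, y). dist x y) ` (S \<times> S)"
    using assms by (force simp: image_iff)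
  then show ?thesis by (simp add: diameter_def)
qed

lemma bounded_isometry_image:
  assumes "\<And>x y. dist (f x) (f y) = dist x y" "bounded S"
  shows "bounded (f ` S)"
  using assms unfolding bounded_any_center[of S] bounded_def by (metis imageE)

text \<open>The images of a cover of \<open>A\<close> cover the image of \<open>A\<close> and have
  the same diameters. For invertible \<open>f\<close> the reverse inequality follows by using the
  inverse.\<close>

lemma hausdorff_outer_isometry_le:
  fixes f :: "'a::metric_space \<Rightarrow> 'b::metric_space"
  assumes "\<And>x y. dist (f x) (f y) = dist x y"
  shows "hausdorff_outer d (f ` A) \<le> hausdorff_outer d A"
proof -
  have "hausdorff_pre d \<delta> (f ` A) \<le> hausdorff_pre d \<delta> A" for \<delta>
    unfolding hausdorff_pre_def
  proof (rule INF_mono)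
    fix C assume C: "C \<in> hausdorff_covers \<delta> A"
    have "(\<lambda>i. f ` C i) \<in> hausdorff_covers \<delta> (f ` A)"
      using C by (auto simp: hausdorff_covers_def diameter_isometry_image[OF assms]
          bounded_isometry_image[OF assms] simp flip: image_UN)
    moreover have "(\<Sum>i. diam_vol d (f ` C i)) = (\<Sum>i. diam_vol d (C i))"
      by (simp add: diam_vol_def diameter_isometry_image[OF assms] cong: if_cong)
    ultimately show "\<exists>D\<in>hausdorff_covers \<delta> (f ` A). (\<Sum>i. diam_vol d (D i)) \<le> (\<Sum>i. diam_vol d (C i))"
      by (intro bexI[of _ "\<lambda>i. f ` C i"]) auto
  qed
  then show ?thesis unfolding hausdorff_outer_def by (rule SUP_mono')
qed

lemma hausdorff_outer_orthogonal_image: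
  fixes g :: "'a::euclidean_space \<Rightarrow> 'a"
  assumes "orthogonal_transformation g"
  shows "hausdorff_outer d (g ` A) = hausdorff_outer d A"
proof (rule antisym)
  have dist: "dist (g x) (g y) = dist x y" if "orthogonal_transformation g" for g :: "'a \<Rightarrow> 'a" and x y
    using that by (simp add: orthogonal_transformation_isometry)
  show "hausdorff_outer d (g ` A) \<le> hausdorff_outer d A"
    by (rule hausdorff_outer_isometry_le[OF dist[OF assms]])
  have "hausdorff_outer d (inv g ` g ` A) \<le> hausdorff_outer d (g ` A)"
    by (rule hausdorff_outer_isometry_le[OF dist[OF orthogonal_transformation_inv[OF assms]]])
  then show "hausdorff_outer d A \<le> hausdorff_outer d (g ` A)"
    using orthogonal_transformation_inj[OF assms] by (simp add: image_image inv_f_f)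
qed

lemma sets_hausdorff_measure [simp]: "sets (hausdorff_measure d) = sets borel"
  and space_hausdorff_measure [simp]: "space (hausdorff_measure d) = UNIV"
  using sets.sigma_sets_eq[of borel]
  by (auto simp: hausdorff_measure_def sets_measure_of_conv space_measure_of_conv)

section \<open>Finiteness of the surface measure of the sphere\<close>

text \<open>The disjoint balls of radius \<open>\<epsilon>/2\<close> around an \<open>\<epsilon>\<close>-separated subset of the sphere all lie in the
  shell between the radii \<open>1 - \<epsilon>/2\<close> and \<open>1 + \<epsilon>/2\<close>, whose volume is \<open>O(\<epsilon>)\<close>.\<close>

lemma card_separated_sphere:
  fixes P :: "'a::euclidean_space set"
  assumes \<epsilon>: "0 < \<epsilon>" "\<epsilon> \<le> 1" and P: "finite P" "P \<subseteq> sphere 0 1"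
    and sep: "\<And>x y. x \<in> P \<Longrightarrow> y \<in> P \<Longrightarrow> x \<noteq> y \<Longrightarrow> \<epsilon> \<le> dist x y"
  shows "real (card P) * (\<epsilon> / 2) ^ (DIM('a) - 1) \<le> DIM('a) * 2 ^ DIM('a)"
proof -
  let ?N = "DIM('a)" and ?c = "measure lborel (ball (0::'a) 1)"
  have c: "?c > 0" by (simp add: content_ball_pos)
  have vol: "measure lborel (ball x r) = r ^ ?N * ?c" if "r \<ge> 0" for x :: 'a and r
    using content_ball_conv_unit_ball[OF that] .
  have disj: "disjoint_family_on (\<lambda>x. ball x (\<epsilon> / 2)) P"
  proof (unfold disjoint_family_on_def, intro ballI impI)
    fix x y assume xy: "x \<in> P" "y \<in> P" "x \<noteq> y"
    have "dist x z < \<epsilon> / 2 \<Longrightarrow> dist y z < \<epsilon> / 2 \<Longrightarrow> False" for z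
      using sep[OF xy] dist_triangle2[of x y z] by linarith
    then show "ball x (\<epsilon> / 2) \<inter> ball y (\<epsilon> / 2) = {}" by auto
  qed
  have sub: "(\<Union>x\<in>P. ball x (\<epsilon> / 2)) \<subseteq> ball 0 (1 + \<epsilon> / 2) - ball 0 (1 - \<epsilon> / 2)"
  proof
    fix z assume "z \<in> (\<Union>x\<in>P. ball x (\<epsilon> / 2))"
    then obtain x where "norm x = 1" "dist x z < \<epsilon> / 2" using P by auto
    moreover have "norm z \<le> norm x + dist x z" "norm x \<le> norm z + dist x z"
      by (metis dist_norm norm_triangle_sub add.commute norm_minus_commute)+
    ultimately show "z \<in> ball 0 (1 + \<epsilon> / 2) - ball 0 (1 - \<epsilon> / 2)" by auto
  qed
  have "real (card P) * ((\<epsilon> / 2) ^ ?N * ?c) = (\<Sum>x\<in>P. measure lborel (ball x (\<epsilon> / 2)))"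
    using \<epsilon> by (simp add: vol[of "\<epsilon> / 2"])
  also have "\<dots> = measure lborel (\<Union>x\<in>P. ball x (\<epsilon> / 2))"
    using P disj emeasure_lborel_ball_finite by (intro measure_finite_Union[symmetric]) (auto simp: less_top)
  also have "\<dots> \<le> measure lborel (ball 0 (1 + \<epsilon> / 2) - ball (0::'a) (1 - \<epsilon> / 2))"
    using sub emeasure_lborel_ball_finite
    by (intro measure_mono_fmeasurable fmeasurable_Diff fmeasurableI) (auto intro!: borel_open)
  also have "\<dots> = ((1 + \<epsilon> / 2) ^ ?N - (1 - \<epsilon> / 2) ^ ?N) * ?c"
    using \<epsilon> vol[of "1 + \<epsilon> / 2" 0] vol[of "1 - \<epsilon> / 2" 0] emeasure_lborel_ball_finite[of "0::'a"]
    by (subst measurable_measure_Diff) (auto simp: left_diff_distrib intro!: fmeasurableI)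
  \<comment> \<open>Factoring the difference of powers produces the factor \<epsilon>. It cancels
    one factor of the ball volume, which leaves the exponent \<open>?N - 1\<close>.\<close>
  also have "(1 + \<epsilon> / 2) ^ ?N - (1 - \<epsilon> / 2) ^ ?N
      = \<epsilon> * (\<Sum>i<?N. (1 - \<epsilon> / 2) ^ (?N - Suc i) * (1 + \<epsilon> / 2) ^ i)"
    by (subst power_diff_sumr2) simp
  also have "\<dots> \<le> \<epsilon> * (\<Sum>i<?N. 2 ^ (?N - 1))"
  proof (intro mult_left_mono sum_mono)
    fix i assume "i \<in> {..<?N}"
    have "(1 - \<epsilon> / 2) ^ (?N - Suc i) * (1 + \<epsilon> / 2) ^ i \<le> 1 * 2 ^ i"
      using \<epsilon> by (intro mult_mono power_le_one power_mono) auto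
    also have "\<dots> \<le> 2 ^ (?N - 1)" using \<open>i \<in> _\<close> by (simp add: power_increasing)
    finally show "(1 - \<epsilon> / 2) ^ (?N - Suc i) * (1 + \<epsilon> / 2) ^ i \<le> 2 ^ (?N - 1)" .
  qed (use \<epsilon> in auto)
  finally have "real (card P) * ((\<epsilon> / 2) ^ ?N * ?c) \<le> \<epsilon> * (?N * 2 ^ (?N - 1)) * ?c"
    using c by simp
  then have "real (card P) * (\<epsilon> / 2) ^ ?N \<le> \<epsilon> * (?N * 2 ^ (?N - 1))"
    using c by (simp add: mult.assoc[symmetric])
  moreover have "(\<epsilon> / 2) ^ ?N = \<epsilon> / 2 * (\<epsilon> / 2) ^ (?N - 1)" "(2::real) ^ ?N = 2 * 2 ^ (?N - 1)"
    by (metis DIM_positive power_eq_if less_irrefl)+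
  ultimately show ?thesis using \<epsilon> by (simp add: field_simps)
qed

text \<open>The cardinality bound permits a separated set of maximal cardinality. A point of the
  sphere farther than \<epsilon> from it could be added, so its closed balls cover.\<close>

lemma ex_separated_net_sphere:
  fixes \<epsilon> :: real
  assumes \<epsilon>: "0 < \<epsilon>" "\<epsilon> \<le> 1"
  obtains P :: "'a::euclidean_space set" where "finite P"
    "real (card P) * (\<epsilon> / 2) ^ (DIM('a) - 1) \<le> DIM('a) * 2 ^ DIM('a)"
    "sphere 0 1 \<subseteq> (\<Union>x\<in>P. cball x \<epsilon>)"
proof -
  define good where "good P \<longleftrightarrow> finite P \<and> P \<subseteq> sphere 0 1 \<and>
    (\<forall>x\<in>P. \<forall>y\<in>P. x \<noteq> y \<longrightarrow> \<epsilon> \<le> dist x y)" for P :: "'a set"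
  define k where "k = nat \<lceil>DIM('a) * 2 ^ DIM('a) / (\<epsilon> / 2) ^ (DIM('a) - 1)\<rceil>"
  have bound: "real (card P) * (\<epsilon> / 2) ^ (DIM('a) - 1) \<le> DIM('a) * 2 ^ DIM('a)" if "good P" for P :: "'a set"
    using card_separated_sphere[OF \<epsilon>] that unfolding good_def by blast
  have "card P < Suc k" if "good P" for P :: "'a set"
  proof -
    have "real (card P) \<le> DIM('a) * 2 ^ DIM('a) / (\<epsilon> / 2) ^ (DIM('a) - 1)"
      using bound[OF that] \<epsilon> by (simp add: pos_le_divide_eq)
    then show ?thesis unfolding k_def by linarith
  qed
  moreover have "good {}" by (simp add: good_def)
  ultimately obtain P where P: "good P" "\<And>Q. good Q \<Longrightarrow> card Q \<le> card P"
    using ex_has_greatest_nat[of good "{}" card "Suc k"] by auto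
  have "sphere 0 1 \<subseteq> (\<Union>x\<in>P. cball x \<epsilon>)"
  proof (rule ccontr)
    assume "\<not> ?thesis"
    then obtain z where z: "z \<in> sphere 0 1" "\<forall>x\<in>P. \<epsilon> < dist x z"
      by (force simp: not_le)
    then have "z \<notin> P" using \<epsilon> by auto
    moreover have "good (insert z P)"
      using P(1) z by (auto simp: good_def dist_commute less_imp_le)
    moreover have "finite P" using P(1) by (simp add: good_def)
    ultimately show False using P(2)[of "insert z P"] by simp
  qed
  moreover have "finite P" using P(1) by (simp add: good_def)
  ultimately show ?thesis using that bound[OF P(1)] by blast
qed

text \<open>A net of scale \<epsilon> has at most a constant times \<open>\<epsilon> ^ (- n)\<close>
  balls, with n the dimension of the sphere, and each costs a constant times
  \<open>\<epsilon> ^ n\<close>. The total stays bounded as \<epsilon> shrinks.\<close>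

lemma hausdorff_outer_sphere_finite:
  "hausdorff_outer (DIM('a) - 1) (sphere (0::'a::euclidean_space) 1) < top"
proof -
  let ?n = "DIM('a) - 1"
  \<comment> \<open>The factor \<open>2 ^ ?n\<close> turns the \<open>(\<epsilon> / 2) ^ ?n\<close>
    of the net bound into \<open>\<epsilon> ^ ?n\<close>.\<close>
  define M where "M = unit_ball_vol (real ?n) * (2 ^ ?n * real (DIM('a) * 2 ^ DIM('a)))"
  have small: "hausdorff_pre ?n (2 * \<epsilon>) (sphere (0::'a) 1) \<le> ennreal M"
    if \<epsilon>: "0 < \<epsilon>" "\<epsilon> \<le> 1" for \<epsilon>
  proof -
    obtain P :: "'a set" where P: "finite P"
      "real (card P) * (\<epsilon> / 2) ^ ?n \<le> DIM('a) * 2 ^ DIM('a)"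
      "sphere 0 1 \<subseteq> (\<Union>x\<in>P. cball x \<epsilon>)"
      using ex_separated_net_sphere[OF \<epsilon>] by blast
    obtain p where p: "bij_betw p {..<card P} P"
      using ex_bij_betw_nat_finite[OF P(1)] by (auto simp: atLeast0LessThan)
    \<comment> \<open>Covers are infinite sequences; the padding sets are empty and have
      \<open>diam_vol\<close> 0.\<close>
    define C where "C i = (if i < card P then cball (p i) \<epsilon> else {})" for i
    have "(\<Union>x\<in>P. cball x \<epsilon>) = (\<Union>i. C i)"
      using bij_betw_imp_surj_on[OF p] by (force simp: C_def image_iff split: if_splits)
    then have "C \<in> hausdorff_covers (2 * \<epsilon>) (sphere 0 1)"
      using P(3) \<epsilon> by (auto simp: hausdorff_covers_def C_def)
    then have "hausdorff_pre ?n (2 * \<epsilon>) (sphere (0::'a) 1) \<le> (\<Sum>i. diam_vol ?n (C i))"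
      unfolding hausdorff_pre_def by (rule INF_lower)
    also have "\<dots> = (\<Sum>i<card P. diam_vol ?n (C i))"
      by (intro suminf_finite) (auto simp: C_def diam_vol_def)
    also have "\<dots> = (\<Sum>i<card P. ennreal (unit_ball_vol (real ?n) * \<epsilon> ^ ?n))"
      using \<epsilon> by (intro sum.cong) (auto simp: C_def diam_vol_def)
    also have "\<dots> = ennreal (unit_ball_vol (real ?n) * (real (card P) * \<epsilon> ^ ?n))"
      using \<epsilon> by (subst sum_ennreal) (auto simp: algebra_simps)
    also have "\<dots> \<le> ennreal M"
    proof (intro ennreal_leI)
      have "real (card P) * \<epsilon> ^ ?n = 2 ^ ?n * (real (card P) * (\<epsilon> / 2) ^ ?n)"
        by (simp add: power_divide)
      also have "\<dots> \<le> 2 ^ ?n * real (DIM('a) * 2 ^ DIM('a))"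
        using P(2) by (intro mult_left_mono) auto
      finally show "unit_ball_vol (real ?n) * (real (card P) * \<epsilon> ^ ?n) \<le> M"
        unfolding M_def by (intro mult_left_mono) auto
    qed
    finally show ?thesis .
  qed
  have "hausdorff_outer ?n (sphere (0::'a) 1) \<le> ennreal M"
    unfolding hausdorff_outer_def
  proof (rule SUP_least)
    fix \<delta> :: real assume "\<delta> \<in> {0<..}"
    \<comment> \<open>The minimum keeps the radius at most 1 and the diameters at most \<delta>; a
      finer scale only increases \<open>hausdorff_pre\<close>.\<close>
    then have "hausdorff_pre ?n \<delta> (sphere (0::'a) 1) \<le> hausdorff_pre ?n (2 * min 1 (\<delta> / 2)) (sphere (0::'a) 1)"
      by (intro hausdorff_pre_antimono) auto
    also have "\<dots> \<le> ennreal M" using \<open>\<delta> \<in> _\<close> by (intro small) auto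
    finally show "hausdorff_pre ?n \<delta> (sphere (0::'a) 1) \<le> ennreal M" .
  qed
  then show ?thesis using ennreal_less_top le_less_trans by blast
qed

section \<open>Equivariance of the spherical Hessian\<close>

text \<open>The chain rule differentiates both sides of the equation for \<phi>. It is used with
  \<open>r\<close> the identity for functions and with \<open>r = g\<close> for gradient
  fields.\<close>

lemma frechet_derivative_equivariant:
  fixes \<phi> :: "'a::real_normed_vector \<Rightarrow> 'b::real_normed_vector"
  assumes g: "bounded_linear g" and r: "bounded_linear r"
    and S: "open S" "x \<in> S" and eq: "\<And>y. y \<in> S \<Longrightarrow> \<phi> (g y) = r (\<phi> y)"
    and diff: "\<phi> differentiable at x" "\<phi> differentiable at (g x)"
  shows "frechet_derivative \<phi> (at (g x)) (g u) = r (frechet_derivative \<phi> (at x) u)"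
proof -
  have 1: "((\<lambda>y. \<phi> (g y)) has_derivative (\<lambda>u. frechet_derivative \<phi> (at (g x)) (g u))) (at x)"
    using has_derivative_compose[OF bounded_linear_imp_has_derivative[OF g]]
      diff(2) frechet_derivative_works by blast
  have "((\<lambda>y. r (\<phi> y)) has_derivative (\<lambda>u. r (frechet_derivative \<phi> (at x) u))) (at x)"
    using bounded_linear.has_derivative[OF r] diff(1) frechet_derivative_works by blast
  then have "((\<lambda>y. \<phi> (g y)) has_derivative (\<lambda>u. r (frechet_derivative \<phi> (at x) u))) (at x)"
    by (rule has_derivative_transform_within_open[OF _ S]) (simp add: eq)
  from has_derivative_unique[OF 1 this] show ?thesis by (rule fun_cong)
qed

lemma orthogonal_transformation_sgn:
  "orthogonal_transformation g \<Longrightarrow> sgn (g x) = g (sgn x)"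
  by (simp add: sgn_div_norm orthogonal_transformation_norm orthogonal_transformation_scaleR)

lemma orthogonal_transformation_bounded_linear:
  fixes g :: "'a::euclidean_space \<Rightarrow> 'a"
  shows "orthogonal_transformation g \<Longrightarrow> bounded_linear g"
  by (simp add: linear_conv_bounded_linear[symmetric] orthogonal_transformation_linear)

lemma sphere_grad_inner:
  assumes "(\<lambda>y. f (sgn y)) differentiable at x"
  shows "sphere_grad f x \<bullet> w = frechet_derivative (\<lambda>y. f (sgn y)) (at x) w"
proof -
  let ?D = "frechet_derivative (\<lambda>y. f (sgn y)) (at x)"
  have "linear ?D" using assms linear_frechet_derivative by blast
  then have "?D (\<Sum>b\<in>Basis. (w \<bullet> b) *\<^sub>R b) = (\<Sum>b\<in>Basis. (w \<bullet> b) *\<^sub>R ?D b)"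
    by (simp add: linear_sum linear_cmul)
  then show ?thesis
    by (simp add: sphere_grad_def inner_commute[of _ w] inner_sum_right euclidean_representation mult.commute)
qed

text \<open>The derivative is the orthogonal projection to the tangent space: \<open>sgn\<close> is
  constant along rays, so the radial part is lost.\<close>

lemma sgn_has_derivative_on_sphere:
  fixes x :: "'a::real_inner"
  assumes "norm x = 1"
  shows "(sgn has_derivative (\<lambda>u. u - (x \<bullet> u) *\<^sub>R x)) (at x)"
proof -
  have "((\<lambda>y. y /\<^sub>R norm y) has_derivative (\<lambda>u. u - (x \<bullet> u) *\<^sub>R x)) (at x)"
    using assms
    by (auto intro!: derivative_eq_intros has_derivative_norm simp: fun_eq_iff sgn_div_norm inner_commute)
  then show ?thesis by (simp add: sgn_div_norm[abs_def])
qed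

text \<open>The gradient is composed with \<open>sgn\<close> before it is differentiated, so the
  ambient second derivative \<open>L\<close> gets the tangential projection in its first slot. The
  formula yields bilinearity in \<open>u\<close> and \<open>v\<close> and, by continuity of
  \<open>L\<close>, uniform bounds.\<close>

lemma C2_on_sphere_hessian:
  fixes f :: "'a::euclidean_space \<Rightarrow> real"
  assumes "C2_on_sphere f"
  obtains L :: "'a \<Rightarrow> 'a \<Rightarrow>\<^sub>L 'a \<Rightarrow>\<^sub>L real" where
    "continuous_on (sphere 0 1) L"
    "\<And>x. x \<noteq> 0 \<Longrightarrow> (\<lambda>y. f (sgn y)) differentiable at x"
    "\<And>x. norm x = 1 \<Longrightarrow> (\<lambda>y. sphere_grad f (sgn y)) differentiable at x"
    "\<And>x u v. norm x = 1 \<Longrightarrow> sphere_hessian f x u v = L x (u - (x \<bullet> u) *\<^sub>R x) v"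
proof -
  obtain F' :: "'a \<Rightarrow> 'a \<Rightarrow>\<^sub>L real" and L :: "'a \<Rightarrow> 'a \<Rightarrow>\<^sub>L 'a \<Rightarrow>\<^sub>L real" where
    F': "\<And>x. x \<noteq> 0 \<Longrightarrow> ((\<lambda>y. f (sgn y)) has_derivative F' x) (at x)" and
    L: "\<And>x. x \<noteq> 0 \<Longrightarrow> (F' has_derivative L x) (at x)" and cont: "continuous_on (- {0}) L"
    using assms unfolding C2_on_sphere_def C2_on_def by auto
  have diff: "(\<lambda>y. f (sgn y)) differentiable at x" if "x \<noteq> 0" for x
    using F'[OF that] by (auto simp: differentiable_def)
  have grad: "sphere_grad f y = (\<Sum>b\<in>Basis. F' y b *\<^sub>R b)" if "y \<noteq> 0" for y
    by (simp add: sphere_grad_def frechet_derivative_at[OF F'[OF that], symmetric])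
  have der: "((\<lambda>y. sphere_grad f (sgn y)) has_derivative
      (\<lambda>u. \<Sum>b\<in>Basis. L x (u - (x \<bullet> u) *\<^sub>R x) b *\<^sub>R b)) (at x)" if x: "norm x = 1" for x
  proof -
    have sgn_x: "sgn x = x" using x by (simp add: sgn_div_norm)
    have "x \<noteq> 0" using x by auto
    have "((\<lambda>y. F' (sgn y)) has_derivative (\<lambda>u. L x (u - (x \<bullet> u) *\<^sub>R x))) (at x)"
      using L[OF \<open>x \<noteq> 0\<close>] sgn_x
      by (intro has_derivative_compose[OF sgn_has_derivative_on_sphere[OF x]]) simp
    then have "((\<lambda>y. \<Sum>b\<in>Basis. F' (sgn y) b *\<^sub>R b) has_derivative
      (\<lambda>u. \<Sum>b\<in>Basis. L x (u - (x \<bullet> u) *\<^sub>R x) b *\<^sub>R b)) (at x)"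
      by (intro has_derivative_sum has_derivative_scaleR_left
          bounded_linear.has_derivative[OF blinfun.bounded_linear_left])
    then show ?thesis
      by (rule has_derivative_transform_within_open[of _ _ _ _ "- {0}"])
         (use \<open>x \<noteq> 0\<close> in \<open>auto simp: grad sgn_zero_iff\<close>)
  qed
  have "sphere_hessian f x u v = L x (u - (x \<bullet> u) *\<^sub>R x) v" if x: "norm x = 1" for x u v
  proof -
    let ?l = "L x (u - (x \<bullet> u) *\<^sub>R x)"
    have "sphere_hessian f x u v = (\<Sum>b\<in>Basis. (v \<bullet> b) *\<^sub>R ?l b)"
      unfolding sphere_hessian_def frechet_derivative_at[OF der[OF x], symmetric]
      by (simp add: inner_commute[of _ v] inner_sum_right mult.commute)
    also have "\<dots> = ?l (\<Sum>b\<in>Basis. (v \<bullet> b) *\<^sub>R b)"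
      by (simp add: blinfun.sum_right blinfun.scaleR_right)
    finally show ?thesis by (simp add: euclidean_representation)
  qed
  moreover have "continuous_on (sphere 0 1) L"
    by (rule continuous_on_subset[OF cont]) auto
  moreover have "(\<lambda>y. sphere_grad f (sgn y)) differentiable at x" if "norm x = 1" for x
    using der[OF that] by (auto simp: differentiable_def)
  ultimately show ?thesis using that diff by blast
qed

text \<open>Equivariance is differentiated twice: the invariant function has an equivariant
  gradient, whose derivative is equivariant in turn.\<close>

lemma sphere_hessian_equivariant:
  fixes f :: "'a::euclidean_space \<Rightarrow> real"
  assumes f: "C2_on_sphere f" and g: "orthogonal_transformation g"
    and inv: "\<And>x. x \<in> sphere 0 1 \<Longrightarrow> f (g x) = f x" and x: "norm x = 1"
  shows "sphere_hessian f (g x) (g u) (g v) = sphere_hessian f x u v"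
proof -
  have lin: "bounded_linear g" "g 0 = 0"
    using g by (auto simp: orthogonal_transformation_bounded_linear linear_0 orthogonal_transformation_linear)
  have nz: "g y \<noteq> 0 \<longleftrightarrow> y \<noteq> 0" for y
    using g by (metis norm_eq_zero orthogonal_transformation_norm)
  have diff: "y \<noteq> 0 \<Longrightarrow> (\<lambda>y. f (sgn y)) differentiable at y"
    "norm y = 1 \<Longrightarrow> (\<lambda>y. sphere_grad f (sgn y)) differentiable at y" for y
    by (rule C2_on_sphere_hessian[OF f]; simp)+
  \<comment> \<open>Invariance is given on the sphere only; at \<open>y = 0\<close> both sides are
    \<open>f 0\<close>.\<close>
  have sgn_inv: "f (sgn (g y)) = f (sgn y)" for y
    by (cases "y = 0") (use g inv lin in \<open>auto simp: orthogonal_transformation_sgn norm_sgn\<close>)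
  have grad: "sphere_grad f (g y) = g (sphere_grad f y)" if "y \<noteq> 0" for y
  proof -
    \<comment> \<open>Testing against vectors \<open>g w\<close> suffices because \<open>g\<close>
      is onto.\<close>
    have "sphere_grad f (g y) \<bullet> g w = g (sphere_grad f y) \<bullet> g w" for w
    proof -
      have "sphere_grad f (g y) \<bullet> g w = frechet_derivative (\<lambda>y. f (sgn y)) (at (g y)) (g w)"
        using nz[of y] that by (intro sphere_grad_inner diff) simp
      also have "\<dots> = frechet_derivative (\<lambda>y. f (sgn y)) (at y) w"
        by (rule frechet_derivative_equivariant[OF lin(1) bounded_linear_ident open_UNIV])
           (use that nz diff sgn_inv in auto)
      also have "\<dots> = sphere_grad f y \<bullet> w" using that by (intro sphere_grad_inner[symmetric] diff)
      finally show ?thesis using g by (simp add: orthogonal_transformation_def)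
    qed
    then have "sphere_grad f (g y) \<bullet> w = g (sphere_grad f y) \<bullet> w" for w
      using orthogonal_transformation_surj[OF g] by (metis surjD)
    then show ?thesis using vector_eq_rdot by blast
  qed
  have "frechet_derivative (\<lambda>y. sphere_grad f (sgn y)) (at (g x)) (g u)
      = g (frechet_derivative (\<lambda>y. sphere_grad f (sgn y)) (at x) u)"
    by (rule frechet_derivative_equivariant[OF lin(1) lin(1), of "- {0}"])
       (use g x diff grad in \<open>auto simp: orthogonal_transformation_sgn orthogonal_transformation_norm sgn_zero_iff\<close>)
  then show ?thesis using g by (simp add: sphere_hessian_def orthogonal_transformation_def)
qed

section \<open>Orthonormal tangent frames and the determinant of the Hessian\<close>

text \<open>A frame consists of \<open>CARD('n)\<close> orthonormal vectors in a hyperplane of that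
  dimension, so it is a basis of it.\<close>

lemma tangent_frame_expand:
  fixes e :: "'n::finite \<Rightarrow> real ^ ('n option)"
  assumes e: "tangent_frame x e" and "x \<noteq> 0" "w \<bullet> x = 0"
  shows "(\<Sum>i\<in>UNIV. (w \<bullet> e i) *\<^sub>R e i) = w"
proof -
  have orth: "e i \<bullet> e j = (if i = j then 1 else 0)" and perp: "e i \<bullet> x = 0" for i j
    using e by (auto simp: tangent_frame_def)
  have inj: "inj e" using orth by (metis injI zero_neq_one)
  have po: "pairwise orthogonal (range e)"
    using orth by (auto simp: pairwise_def orthogonal_def)
  have nrm: "norm b = 1" if "b \<in> range e" for b using orth that by (auto simp: norm_eq_1)
  have "independent (range e)"
    using po nrm by (intro pairwise_orthogonal_independent) fastforce+
  moreover have "dim {y. x \<bullet> y = 0} = CARD('n)" using dim_hyperplane[OF \<open>x \<noteq> 0\<close>] by simp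
  moreover have "card (range e) = CARD('n)" using inj by (simp add: card_image)
  ultimately have "{y. x \<bullet> y = 0} \<subseteq> span (range e)"
    using perp by (intro card_ge_dim_independent) (auto simp: inner_commute)
  then have "w \<in> span (range e)" using assms(3) by (auto simp: inner_commute)
  then have "(\<Sum>b\<in>range e. (w \<bullet> b) *\<^sub>R b) = w"
    using po nrm by (intro orthonormal_basis_expand) auto
  then show ?thesis using inj by (simp add: sum.reindex)
qed

text \<open>With \<open>Q\<close> the transition matrix between the frames, the Gram matrix
  \<open>M\<close> of \<open>B\<close> becomes \<open>Q ** M ** transpose Q\<close>.\<close>

lemma tangent_frame_gram_change:
  fixes e e' :: "'n::finite \<Rightarrow> real ^ ('n option)" and B :: "_ \<Rightarrow> _ \<Rightarrow> real"
  assumes e: "tangent_frame x e" and e': "tangent_frame x e'" and "x \<noteq> 0" and B: "bilinear B"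
  shows "det (\<chi> i j. B (e' i) (e' j)) = (det (\<chi> i j. e' i \<bullet> e j))\<^sup>2 * det (\<chi> i j. B (e i) (e j))"
proof -
  define Q :: "real ^ 'n ^ 'n" where "Q = (\<chi> i j. e' i \<bullet> e j)"
  define M :: "real ^ 'n ^ 'n" where "M = (\<chi> i j. B (e i) (e j))"
  have exp: "e' i = (\<Sum>k\<in>UNIV. Q $ i $ k *\<^sub>R e k)" for i
    using tangent_frame_expand[OF e \<open>x \<noteq> 0\<close>, of "e' i"] e' by (simp add: Q_def tangent_frame_def)
  have "B (e' i) (e' j) = (Q ** M ** transpose Q) $ i $ j" for i j
  proof -
    have "B (e' i) (e' j) = (\<Sum>k\<in>UNIV. \<Sum>l\<in>UNIV. Q $ i $ k * Q $ j $ l * M $ k $ l)"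
      unfolding exp bilinear_sum[OF B]
      by (simp add: sum.cartesian_product M_def bilinear_lmul[OF B] bilinear_rmul[OF B] mult_ac)
    also have "\<dots> = (\<Sum>l\<in>UNIV. \<Sum>k\<in>UNIV. Q $ i $ k * M $ k $ l * Q $ j $ l)"
      by (subst sum.swap) (simp add: mult_ac)
    finally show ?thesis
      by (simp add: matrix_matrix_mult_def transpose_def sum_distrib_right)
  qed
  then have "(\<chi> i j. B (e' i) (e' j)) = Q ** M ** transpose Q" by (simp add: vec_eq_iff)
  then show ?thesis by (simp add: det_mul det_transpose power2_eq_square Q_def M_def)
qed

text \<open>The change formula applied to the inner product itself, whose Gram matrix is the
  identity in every frame, shows that the transition determinant squares to 1.\<close>

lemma tangent_frame_gram_invariant:
  fixes e e' :: "'n::finite \<Rightarrow> real ^ ('n option)" and B :: "_ \<Rightarrow> _ \<Rightarrow> real"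
  assumes "tangent_frame x e" "tangent_frame x e'" "x \<noteq> 0" "bilinear B"
  shows "det (\<chi> i j. B (e' i) (e' j)) = det (\<chi> i j. B (e i) (e j))"
proof -
  have "(\<chi> i j. e i \<bullet> e j) = (mat 1 :: real ^ 'n ^ 'n)" if "tangent_frame x e" for e
    using that by (simp add: tangent_frame_def mat_def vec_eq_iff)
  then have "(det (\<chi> i j. e' i \<bullet> e j))\<^sup>2 = 1"
    using tangent_frame_gram_change[OF assms(1-3), of "(\<bullet>)"] assms
    by (simp add: bilinear_def linear_iff inner_add_left inner_add_right)
  then show ?thesis using tangent_frame_gram_change[OF assms] by simp
qed

text \<open>This removes the arbitrary choice of frame from \<open>det_hessian\<close>. Writing the
  identity matrix through \<open>e i \<bullet> e j\<close> makes the whole matrix the Gram matrix of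
  one bilinear form.\<close>

lemma det_hessian_eq_frame:
  fixes f :: "real ^ ('n::finite option) \<Rightarrow> real"
  assumes f: "C2_on_sphere f" and x: "norm x = 1" and e: "tangent_frame x e"
  shows "det_hessian f x = det (\<chi> i j. sphere_hessian f x (e i) (e j) + f x * (e i \<bullet> e j))"
proof -
  obtain L :: "_ \<Rightarrow> _ \<Rightarrow>\<^sub>L _ \<Rightarrow>\<^sub>L real" where L:
    "\<And>x u v. norm x = 1 \<Longrightarrow> sphere_hessian f x u v = L x (u - (x \<bullet> u) *\<^sub>R x) v"
    by (rule C2_on_sphere_hessian[OF f]) (rule that)
  have B: "bilinear (\<lambda>u v. sphere_hessian f x u v + f x * (u \<bullet> v))"
    unfolding bilinear_def linear_iff L[OF x]
    by (simp add: blinfun.add_right blinfun.scaleR_right algebra_simps inner_add_left inner_add_right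
        blinfun.add_left blinfun.scaleR_left blinfun.diff_right blinfun.diff_left)
  have "x \<noteq> 0" using x by auto
  define e' where "e' = (SOME e. tangent_frame x e)"
  have e': "tangent_frame x e'" unfolding e'_def using ex_tangent_frame[OF \<open>x \<noteq> 0\<close>] by (rule someI_ex)
  then have "(\<chi> i j. sphere_hessian f x (e' i) (e' j)) + f x *\<^sub>R (mat 1 :: real ^ 'n ^ 'n)
      = (\<chi> i j. sphere_hessian f x (e' i) (e' j) + f x * (e' i \<bullet> e' j))"
    by (simp add: vec_eq_iff mat_def tangent_frame_def)
  then have "det_hessian f x = det (\<chi> i j. sphere_hessian f x (e' i) (e' j) + f x * (e' i \<bullet> e' j))"
    by (simp add: det_hessian_def flip: e'_def)
  then show ?thesis using tangent_frame_gram_invariant[OF e e' \<open>x \<noteq> 0\<close> B] by simp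
qed

text \<open>The map \<open>g\<close> carries a frame at \<open>x\<close> to a frame at
  \<open>g x\<close>, in which the matrix has the same entries.\<close>

lemma det_hessian_equivariant:
  fixes f :: "real ^ ('n::finite option) \<Rightarrow> real"
  assumes f: "C2_on_sphere f" and g: "orthogonal_transformation g"
    and inv: "\<And>x. x \<in> sphere 0 1 \<Longrightarrow> f (g x) = f x" and x: "norm x = 1"
  shows "det_hessian f (g x) = det_hessian f x"
proof -
  obtain e :: "'n \<Rightarrow> real ^ ('n option)" where e: "tangent_frame x e"
    using ex_tangent_frame x by (metis norm_zero zero_neq_one)
  have "tangent_frame (g x) (\<lambda>i. g (e i))"
    using e g by (simp add: tangent_frame_def orthogonal_transformation_def)
  then have "det_hessian f (g x)
      = det (\<chi> i j. sphere_hessian f (g x) (g (e i)) (g (e j)) + f (g x) * (g (e i) \<bullet> g (e j)))"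
    using x g by (intro det_hessian_eq_frame[OF f]) (simp add: orthogonal_transformation_norm)
  also have "\<dots> = det (\<chi> i j. sphere_hessian f x (e i) (e j) + f x * (e i \<bullet> e j))"
  proof -
    have "sphere_hessian f (g x) (g u) (g v) = sphere_hessian f x u v" for u v
      using sphere_hessian_equivariant[OF f g _ x] inv by blast
    moreover have "g u \<bullet> g v = u \<bullet> v" for u v
      using g by (simp add: orthogonal_transformation_def)
    moreover have "f (g x) = f x" using inv x by simp
    ultimately show ?thesis by simp
  qed
  also have "\<dots> = det_hessian f x" by (rule det_hessian_eq_frame[OF f x e, symmetric])
  finally show ?thesis .
qed

lemma abs_det_le:
  fixes A :: "real ^ 'n ^ 'n"
  assumes "\<And>i j. \<bar>A $ i $ j\<bar> \<le> C"
  shows "\<bar>det A\<bar> \<le> fact CARD('n) * C ^ CARD('n)"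
proof -
  have "\<bar>det A\<bar> \<le> (\<Sum>p\<in>{p. p permutes (UNIV :: 'n set)}. \<bar>of_int (sign p) * (\<Prod>i\<in>UNIV. A $ i $ p i)\<bar>)"
    unfolding det_def by (rule sum_abs)
  also have "\<dots> \<le> (\<Sum>p\<in>{p. p permutes (UNIV :: 'n set)}. C ^ CARD('n))"
  proof (rule sum_mono)
    fix p :: "'n \<Rightarrow> 'n"
    have "\<bar>of_int (sign p) * (\<Prod>i\<in>UNIV. A $ i $ p i)\<bar> = (\<Prod>i\<in>UNIV. \<bar>A $ i $ p i\<bar>)"
      by (simp add: abs_mult abs_prod sign_def)
    also have "\<dots> \<le> (\<Prod>i\<in>(UNIV :: 'n set). C)" using assms by (intro prod_mono) auto
    finally show "\<bar>of_int (sign p) * (\<Prod>i\<in>UNIV. A $ i $ p i)\<bar> \<le> C ^ CARD('n)" by simp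
  qed
  also have "\<dots> = fact CARD('n) * C ^ CARD('n)" by (simp add: card_permutations)
  finally show ?thesis .
qed

lemma C2_on_sphere_continuous:
  assumes "C2_on_sphere f"
  shows "continuous_on (sphere 0 1) f"
proof -
  have "(\<lambda>y. f (sgn y)) differentiable at x" if "x \<noteq> 0" for x
    by (rule C2_on_sphere_hessian[OF assms]) (use that in simp)
  then have "continuous_on (sphere 0 1) (\<lambda>y. f (sgn y))"
    by (intro continuous_at_imp_continuous_on ballI differentiable_imp_continuous_within)
      (metis mem_sphere_0 norm_zero zero_neq_one)
  then show ?thesis by (rule continuous_on_eq) (simp add: sgn_div_norm)
qed

text \<open>\<open>L\<close> and \<open>f\<close> are continuous on a compact sphere, which bounds
  the matrix entries in every orthonormal frame at once. The bound makes the cone volume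
  finite.\<close>

lemma det_hessian_bounded:
  fixes f :: "real ^ ('n::finite option) \<Rightarrow> real"
  assumes f: "C2_on_sphere f"
  obtains M where "\<And>x. norm x = 1 \<Longrightarrow> \<bar>det_hessian f x\<bar> \<le> M"
proof -
  obtain L :: "_ \<Rightarrow> _ \<Rightarrow>\<^sub>L _ \<Rightarrow>\<^sub>L real" where L: "continuous_on (sphere 0 1) L"
    "\<And>x u v. norm x = 1 \<Longrightarrow> sphere_hessian f x u v = L x (u - (x \<bullet> u) *\<^sub>R x) v"
    by (rule C2_on_sphere_hessian[OF f]) (rule that)
  have "bounded (L ` sphere 0 1)" "bounded (f ` sphere 0 1)"
    using L(1) C2_on_sphere_continuous[OF f]
    by (auto intro!: compact_imp_bounded compact_continuous_image)
  then obtain b c where b: "\<And>x. norm x = 1 \<Longrightarrow> norm (L x) \<le> b" and c: "\<And>x. norm x = 1 \<Longrightarrow> \<bar>f x\<bar> \<le> c"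
    unfolding bounded_iff by (metis image_eqI mem_sphere_0 real_norm_def)
  have "\<bar>det_hessian f x\<bar> \<le> fact CARD('n) * (b + c) ^ CARD('n)" if x: "norm x = 1" for x
  proof -
    obtain e :: "'n \<Rightarrow> real ^ ('n option)" where e: "tangent_frame x e"
      using ex_tangent_frame x by (metis norm_zero zero_neq_one)
    then have ne: "norm (e i) = 1" and ex: "x \<bullet> e i = 0" for i
      by (auto simp: tangent_frame_def norm_eq_1 inner_commute)
    have "\<bar>sphere_hessian f x (e i) (e j) + f x * (e i \<bullet> e j)\<bar> \<le> b + c" for i j
    proof -
      have "\<bar>L x (e i) (e j)\<bar> \<le> norm (L x (e i)) * norm (e j)"
        using norm_blinfun[of "L x (e i)" "e j"] by simp
      also have "\<dots> \<le> norm (L x) * norm (e i) * norm (e j)"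
        by (intro mult_right_mono norm_blinfun) auto
      finally have "\<bar>sphere_hessian f x (e i) (e j)\<bar> \<le> b"
        using b[OF x] by (simp add: ne L(2)[OF x] ex)
      moreover have "\<bar>f x * (e i \<bullet> e j)\<bar> \<le> c"
        using e c[OF x] by (auto simp: tangent_frame_def)
      ultimately show ?thesis by linarith
    qed
    then show ?thesis unfolding det_hessian_eq_frame[OF f x e] by (intro abs_det_le) simp
  qed
  then show ?thesis by (rule that)
qed

section \<open>Invariance and finiteness of the cone volume\<close>

lemma space_sphere_measure [simp]: "space sphere_measure = sphere 0 1"
  by (simp add: sphere_measure_def space_restrict_space)

lemma sets_sphere_measure: "sets sphere_measure = sets (restrict_space borel (sphere 0 1))"
  unfolding sphere_measure_def by (rule sets_restrict_space_cong) simp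

lemma emeasure_sphere_measure:
  assumes "A \<in> sets sphere_measure"
  shows "emeasure (sphere_measure :: (real ^ ('n::finite option)) measure) A = hausdorff_outer CARD('n) A"
proof -
  have A: "A \<in> sets borel" "A \<subseteq> sphere 0 1"
    using assms unfolding sets_sphere_measure by (auto simp: sets_restrict_space_iff)
  then show ?thesis
    unfolding sphere_measure_def by (simp add: emeasure_restrict_space emeasure_hausdorff_measure)
qed

lemma measurable_sphere_measure_orthogonal:
  assumes "orthogonal_transformation (g :: real ^ ('n::finite option) \<Rightarrow> real ^ ('n option))"
  shows "g \<in> measurable sphere_measure sphere_measure"
proof -
  have "g \<in> borel_measurable borel"
    using assms by (intro borel_measurable_continuous_onI linear_continuous_on)
      (simp add: linear_conv_bounded_linear[symmetric] orthogonal_transformation_linear)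
  then have "g \<in> measurable (restrict_space borel (sphere 0 1)) (restrict_space borel (sphere 0 1))"
    using assms by (intro measurable_restrict_space3) (auto simp: orthogonal_transformation_norm)
  then show ?thesis
    by (simp add: measurable_cong_sets[OF sets_sphere_measure sets_sphere_measure])
qed

lemma distr_sphere_measure_orthogonal:
  assumes g: "orthogonal_transformation (g :: real ^ ('n::finite option) \<Rightarrow> real ^ ('n option))"
  shows "distr sphere_measure sphere_measure g = sphere_measure"
proof (rule measure_eqI)
  fix A assume "A \<in> sets (distr sphere_measure sphere_measure g)"
  then have A: "A \<in> sets sphere_measure" by simp
  then have "A \<subseteq> sphere 0 1" using sets.sets_into_space by fastforce
  \<comment> \<open>The outer measure is known to be invariant for images, so the preimage is
    written as an image under the inverse.\<close>
  then have vimage: "g -` A \<inter> sphere 0 1 = inv g ` A"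
    using bij_vimage_eq_inv_image[OF orthogonal_transformation_bij[OF g], of A]
      orthogonal_transformation_norm[OF orthogonal_transformation_inv[OF g]]
    by auto
  have "g -` A \<inter> space sphere_measure \<in> sets sphere_measure"
    using measurable_sets[OF measurable_sphere_measure_orthogonal[OF g] A] .
  then show "emeasure (distr sphere_measure sphere_measure g) A = emeasure sphere_measure A"
    using A by (simp add: emeasure_distr measurable_sphere_measure_orthogonal[OF g] vimage
        emeasure_sphere_measure hausdorff_outer_orthogonal_image orthogonal_transformation_inv[OF g])
qed simp

text \<open>The integral of \<open>f\<close> is a supremum over simple functions below
  \<open>f\<close>, and for these the change of variables is exact. A simple function below
  \<open>f \<circ> T\<close> need not factor through \<open>T\<close>, so this argument gives one
  inequality only.\<close>

lemma nn_integral_distr_le: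
  assumes T: "T \<in> measurable M M'"
  shows "(\<integral>\<^sup>+x. f x \<partial>distr M M' T) \<le> (\<integral>\<^sup>+x. f (T x) \<partial>M)"
proof -
  have "integral\<^sup>S (distr M M' T) s \<le> (\<integral>\<^sup>+x. f (T x) \<partial>M)"
    if s: "simple_function (distr M M' T) s" "s \<le> f" for s
  proof -
    have "integral\<^sup>S (distr M M' T) s = (\<integral>\<^sup>+x. s (T x) \<partial>M)"
      using s(1) T by (subst nn_integral_eq_simple_integral[symmetric])
        (auto intro!: nn_integral_distr dest: borel_measurable_simple_function)
    also have "\<dots> \<le> (\<integral>\<^sup>+x. f (T x) \<partial>M)"
      using s(2) by (intro nn_integral_mono) (simp add: le_fun_def)
    finally show ?thesis .
  qed
  then show ?thesis unfolding nn_integral_def[of "distr M M' T"] by (intro SUP_least) simp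
qed

text \<open>No measurability of \<open>f\<close> is assumed here. This spares us from showing that
  \<^const>\<open>det_hessian\<close> is measurable, although it is defined by a choice of frames.\<close>

lemma nn_integral_sphere_measure_orthogonal:
  assumes g: "orthogonal_transformation (g :: real ^ ('n::finite option) \<Rightarrow> real ^ ('n option))"
  shows "(\<integral>\<^sup>+x. f (g x) \<partial>sphere_measure) = (\<integral>\<^sup>+x. f x \<partial>sphere_measure)"
proof (rule antisym)
  have le: "(\<integral>\<^sup>+x. f x \<partial>sphere_measure) \<le> (\<integral>\<^sup>+x. f (g x) \<partial>sphere_measure)"
    if "orthogonal_transformation g" for g :: "real ^ ('n option) \<Rightarrow> real ^ ('n option)" and f
    using nn_integral_distr_le[OF measurable_sphere_measure_orthogonal[OF that], of f]
    by (simp add: distr_sphere_measure_orthogonal[OF that])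
  show "(\<integral>\<^sup>+x. f x \<partial>sphere_measure) \<le> (\<integral>\<^sup>+x. f (g x) \<partial>sphere_measure)" by (rule le[OF g])
  \<comment> \<open>The same inequality for the inverse of \<open>g\<close>, applied to
    \<open>f \<circ> g\<close>.\<close>
  show "(\<integral>\<^sup>+x. f (g x) \<partial>sphere_measure) \<le> (\<integral>\<^sup>+x. f x \<partial>sphere_measure)"
    using le[OF orthogonal_transformation_inv[OF g], of "\<lambda>x. f (g x)"]
    by (simp add: surj_f_inv_f[OF orthogonal_transformation_surj[OF g]])
qed

text \<open>For a non-measurable \<open>w\<close>, the set function on the right may fail to be a measure, and then
  \<^const>\<open>density\<close> is the null measure.\<close>

lemma emeasure_density_conv:
  assumes "A \<in> sets M"
  shows "emeasure (density M w) A =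
    (if measure_space (space M) (sets M) (\<lambda>A. \<integral>\<^sup>+x. w x * indicator A x \<partial>M)
     then \<integral>\<^sup>+x. w x * indicator A x \<partial>M else 0)"
  using assms unfolding density_def emeasure_measure_of_conv by (simp add: sets.sigma_sets_eq)

text \<open>Invariance of \<open>w\<close> and of the integral makes the defining set function
  invariant. The case distinction in \<open>emeasure_density_conv\<close> does not depend on
  \<open>A\<close>, so both sides fall in the same case.\<close>

lemma distr_density_sphere_measure:
  assumes g: "orthogonal_transformation (g :: real ^ ('n::finite option) \<Rightarrow> real ^ ('n option))"
    and w: "\<And>x. x \<in> sphere 0 1 \<Longrightarrow> w (g x) = w x"
  shows "distr (density sphere_measure w) (density sphere_measure w) g = density sphere_measure w"
    (is "distr ?\<nu> ?\<nu> g = ?\<nu>")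
proof (rule measure_eqI)
  fix A assume "A \<in> sets (distr ?\<nu> ?\<nu> g)"
  then have A: "A \<in> sets sphere_measure" by simp
  have meas: "g \<in> measurable sphere_measure sphere_measure"
    by (rule measurable_sphere_measure_orthogonal[OF g])
  have "(\<integral>\<^sup>+x. w x * indicator (g -` A \<inter> sphere 0 1) x \<partial>sphere_measure)
      = (\<integral>\<^sup>+x. w (g x) * indicator A (g x) \<partial>sphere_measure)"
    by (intro nn_integral_cong) (simp add: w split: split_indicator)
  also have "\<dots> = (\<integral>\<^sup>+x. w x * indicator A x \<partial>sphere_measure)"
    by (rule nn_integral_sphere_measure_orthogonal[OF g])
  finally have "emeasure ?\<nu> (g -` A \<inter> sphere 0 1) = emeasure ?\<nu> A"
    using A measurable_sets[OF meas A] by (simp add: emeasure_density_conv)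
  moreover have "g \<in> measurable ?\<nu> ?\<nu>" using meas by simp
  ultimately show "emeasure (distr ?\<nu> ?\<nu> g) A = emeasure ?\<nu> A"
    using A by (simp add: emeasure_distr)
qed simp

lemma finite_density_sphere_measure:
  assumes "\<And>x. x \<in> sphere 0 1 \<Longrightarrow> w x \<le> ennreal M"
  shows "finite_measure (density (sphere_measure :: (real ^ ('n::finite option)) measure) w)"
proof
  let ?\<sigma> = "sphere_measure :: (real ^ ('n option)) measure"
  have "emeasure ?\<sigma> (space ?\<sigma>) = hausdorff_outer CARD('n) (sphere (0 :: real ^ ('n option)) 1)"
    using emeasure_sphere_measure[OF sets.top[of ?\<sigma>]] by simp
  also have "\<dots> < top" using hausdorff_outer_sphere_finite[where 'a = "real ^ ('n option)"] by simp
  finally have fin: "emeasure ?\<sigma> (space ?\<sigma>) < top" .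
  \<comment> \<open>An inequality, so as to include the case in which \<open>density\<close> is the
    null measure.\<close>
  have "emeasure (density ?\<sigma> w) (space ?\<sigma>) \<le> (\<integral>\<^sup>+x. w x * indicator (space ?\<sigma>) x \<partial>?\<sigma>)"
    using emeasure_density_conv[OF sets.top[of ?\<sigma>], of w] by simp
  also have "\<dots> \<le> (\<integral>\<^sup>+x. ennreal M \<partial>?\<sigma>)"
    using assms by (intro nn_integral_mono) simp
  also have "\<dots> < top" using fin by (simp add: ennreal_mult_less_top)
  finally show "emeasure (density ?\<sigma> w) (space (density ?\<sigma> w)) \<noteq> \<infinity>" by simp
qed

text \<open>The density is bounded above, so the measure is finite, and a continuous function on the
  compact sphere is bounded.\<close>

lemma integrable_cone_volume:
  fixes K :: "(real ^ ('n::finite option)) set"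
  assumes K: "C2_on_sphere (support_fun K)" and \<phi>: "continuous_on (sphere 0 1) (\<phi> :: _ \<Rightarrow> real)"
  shows "integrable (cone_volume K) \<phi>"
proof -
  obtain M where M: "\<And>x. norm x = 1 \<Longrightarrow> \<bar>det_hessian (support_fun K) x\<bar> \<le> M"
    using det_hessian_bounded[OF K] by blast
  have bdd: "\<exists>b. \<forall>x\<in>sphere 0 1. \<bar>\<psi> x\<bar> \<le> b"
    if "continuous_on (sphere 0 1) \<psi>" for \<psi> :: "real ^ ('n option) \<Rightarrow> real"
    using compact_imp_bounded[OF compact_continuous_image[OF that]] by (auto simp: bounded_iff)
  obtain c where c: "\<And>x. norm x = 1 \<Longrightarrow> \<bar>support_fun K x\<bar> \<le> c"
    using bdd[OF C2_on_sphere_continuous[OF K]] by (auto simp: Ball_def)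
  \<comment> \<open>An upper bound is enough: \<open>ennreal\<close> sends negative values to
    0.\<close>
  have "support_fun K x * det_hessian (support_fun K) x \<le> c * M" if "norm x = 1" for x
  proof -
    have "\<bar>support_fun K x * det_hessian (support_fun K) x\<bar> \<le> c * M"
      using c[OF that] M[OF that] unfolding abs_mult by (intro mult_mono) auto
    then show ?thesis by linarith
  qed
  then interpret finite_measure "cone_volume K"
    unfolding cone_volume_def by (intro finite_density_sphere_measure[of _ "c * M"] ennreal_leI) auto
  obtain b where "\<forall>x\<in>sphere 0 1. \<bar>\<phi> x\<bar> \<le> b" using bdd[OF \<phi>] by blast
  then have "AE x in cone_volume K. norm (\<phi> x) \<le> b"
    by (intro AE_I2) (simp add: cone_volume_def)
  moreover have "\<phi> \<in> borel_measurable (cone_volume K)"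
    using borel_measurable_continuous_on_restrict[OF \<phi>] unfolding cone_volume_def
    by (simp add: measurable_cong_sets[OF sets_sphere_measure refl])
  ultimately show ?thesis by (rule integrable_const_bound)
qed

section \<open>Isotropy of the weighted second moments\<close>

theorem theorem1p3:
  fixes T K :: "(real ^ ('n::finite option)) set"
  assumes "CARD('n) \<ge> 2"
    and "regular_polytope T" and "centered_at_origin T"
    and "K \<in> strongly_symmetric_bodies T"
    and "0 \<in> K"
    and "\<forall>x\<in>sphere 0 1. support_fun K x > 0"
    and "C2_on_sphere (support_fun K)"
  shows "\<forall>\<alpha> \<beta> :: 'n option.
    (\<integral>x. x $ \<alpha> * x $ \<beta> / (support_fun K x)\<^sup>2 \<partial>cone_volume K) =
      (if \<alpha> = \<beta> then 1 else 0) / (real CARD('n) + 1) *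
        (\<integral>x. 1 / (support_fun K x)\<^sup>2 \<partial>cone_volume K)"
proof -
  let ?h = "support_fun K" and ?\<nu> = "cone_volume K"
  define B where "B u v = (\<integral>x. (u \<bullet> x) * (v \<bullet> x) / (?h x)\<^sup>2 \<partial>?\<nu>)" for u v
  have C2: "C2_on_sphere ?h" and nz: "\<forall>x\<in>sphere 0 1. ?h x \<noteq> 0" using assms by force+
  have int: "integrable ?\<nu> (\<lambda>x. (u \<bullet> x) * (v \<bullet> x) / (?h x)\<^sup>2)" for u v
    using nz by (intro integrable_cone_volume[OF C2] continuous_intros C2_on_sphere_continuous[OF C2]) auto
  have "linear (\<lambda>u. B u v)" for v
  proof (rule linearI)
    show "B (u + u') v = B u v + B u' v" for u u'
      by (simp add: B_def inner_add_left distrib_right add_divide_distrib int)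
    show "B (r *\<^sub>R u) v = r *\<^sub>R B u v" for r u
      unfolding B_def real_scaleR_def
      by (subst integral_mult_right_zero[symmetric]) (simp add: mult_ac)
  qed
  \<comment> \<open>Symmetry transfers linearity to the second argument.\<close>
  moreover have "B u v = B v u" for u v by (simp add: B_def mult.commute)
  ultimately have "bilinear B" by (simp add: bilinear_def)
  moreover have "B (g u) (g v) = B u v" if g: "g \<in> symmetry_group T" for g u v
  proof -
    have orth: "orthogonal_transformation g" using g by (simp add: symmetry_group_def)
    have inv: "?h (g x) = ?h x" if "x \<in> sphere 0 1" for x
      using assms(4) g that by (auto simp: strongly_symmetric_bodies_def)
    have "det_hessian ?h (g x) = det_hessian ?h x" if "x \<in> sphere 0 1" for x
      using det_hessian_equivariant[OF C2 orth inv] that by simp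
    then have distr: "distr ?\<nu> ?\<nu> g = ?\<nu>"
      unfolding cone_volume_def using orth inv by (intro distr_density_sphere_measure) simp_all
    have meas: "g \<in> measurable ?\<nu> ?\<nu>"
      using measurable_sphere_measure_orthogonal[OF orth] by (simp add: cone_volume_def)
    \<comment> \<open>The measure is replaced by its pushforward under \<open>g\<close>; changing
      variables puts \<open>g\<close> into every factor of the integrand, where orthogonality and
      the invariance of \<open>?h\<close> remove it.\<close>
    have "B (g u) (g v) = (\<integral>x. (g u \<bullet> x) * (g v \<bullet> x) / (?h x)\<^sup>2 \<partial>distr ?\<nu> ?\<nu> g)"
      by (simp add: B_def distr)
    also have "\<dots> = (\<integral>x. (g u \<bullet> g x) * (g v \<bullet> g x) / (?h (g x))\<^sup>2 \<partial>?\<nu>)"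
      using int by (intro integral_distr meas) (rule borel_measurable_integrable)
    also have "\<dots> = B u v"
      unfolding B_def using orth inv
      by (intro Bochner_Integration.integral_cong) (auto simp: orthogonal_transformation_def cone_volume_def)
    finally show ?thesis .
  qed
  ultimately obtain c where c: "\<And>u v. B u v = c * (u \<bullet> v)"
    using invariant_bilinear_form[OF assms(2,3)] by blast
  have coord: "(\<integral>x. x $ \<alpha> * x $ \<beta> / (?h x)\<^sup>2 \<partial>?\<nu>) = c * (if \<alpha> = \<beta> then 1 else 0)" for \<alpha> \<beta>
    using c[of "axis \<alpha> 1" "axis \<beta> 1"] unfolding B_def inner_axis' by (simp add: axis_def)
  \<comment> \<open>The trace of \<open>B\<close>: the squared coordinates sum to 1 on the sphere.
    As \<open>'n option\<close> has \<open>CARD('n) + 1\<close> elements, this determines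
    \<open>c\<close>.\<close>
  have "(\<integral>x. 1 / (?h x)\<^sup>2 \<partial>?\<nu>) = (\<integral>x. (\<Sum>\<alpha>\<in>UNIV. x $ \<alpha> * x $ \<alpha> / (?h x)\<^sup>2) \<partial>?\<nu>)"
    by (intro Bochner_Integration.integral_cong)
       (auto simp: cone_volume_def norm_eq_1 inner_vec_def simp flip: sum_divide_distrib)
  also have "\<dots> = (\<Sum>\<alpha>\<in>UNIV. \<integral>x. x $ \<alpha> * x $ \<alpha> / (?h x)\<^sup>2 \<partial>?\<nu>)"
    using int[of "axis \<alpha> 1" "axis \<alpha> 1" for \<alpha>]
    by (intro Bochner_Integration.integral_sum) (simp add: inner_axis')
  also have "\<dots> = (real CARD('n) + 1) * c" by (simp add: coord algebra_simps)
  finally show ?thesis by (auto simp: coord)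
qed

end
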